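(* Let $H:\mathbb{R}^2\to\mathbb{R}$ be a positive Lipschitz function such that there exists $\vec{e}\in\mathbb{R}^2$ with $$\langle \nabla H(x),\vec{e}\rangle>0\quad\text{for almost every }x\in\mathbb{R}^2.$$ Then there exists no $C^1$ closed curve immersed in $\mathbb{R}^2$ whose curvature at every point $x$ of the curve is $H(x)$.
   Context: Here $\langle\cdot,\cdot\rangle$ is the Euclidean inner product, and $\nabla H$ exists almost everywhere because $H$ is Lipschitz. A $C^1$ closed immersed curve of length $L>0$ is given by an arc-length parametrization $\gamma:\mathbb{R}/L\mathbb{Z}\to\mathbb{R}^2$ of class $C^1$ (closing up in a $C^1$ way); self-intersections are allowed. All curves are assumed to be at least $C^2_p$, meaning continuous with piecewise continuous first and second derivatives. Let $\vec{t}(s)=\gamma'(s)$ be the unit tangent and $\vec{n}(s)$ the unit vector such that $(\vec{t}(s),\vec{n}(s))$ is a positively oriented orthonormal basis of $\mathbb{R}^2$. That the curve has curvature $H(x)$ at every point $x$ means that on every $C^2$ piece of $\gamma$, $$\frac{d\vec{t}}{ds}(s)=H(\gamma(s))\,\vec{n}(s).$$ *)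

theory Defs
  imports "HOL-Analysis.Analysis"
begin

text \<open>A closed curve of length \<open>L\<close>, that is, a map on \<open>\<real>/L\<int>\<close>, is represented by
  an \<open>L\<close>-periodic function on \<open>\<real>\<close>; periodicity together with differentiability on all of
  \<open>\<real>\<close> makes it close up in a \<open>C\<^sup>1\<close> way. Injectivity on a period is not required.\<close>

definition unit_tangent :: "(real \<Rightarrow> real^2) \<Rightarrow> real \<Rightarrow> real^2" where
  "unit_tangent \<gamma> s = vector_derivative \<gamma> (at s)"

definition C1_closed_curve :: "real \<Rightarrow> (real \<Rightarrow> real^2) \<Rightarrow> bool" where
  "C1_closed_curve L \<gamma> \<longleftrightarrow>
     L > 0 \<and> (\<forall>s. \<gamma> (s + L) = \<gamma> s) \<and> \<gamma> C1_differentiable_on UNIV \<and>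
     (\<forall>s. norm (unit_tangent \<gamma> s) = 1)"

definition pos_orthonormal_basis :: "real^2 \<Rightarrow> real^2 \<Rightarrow> bool" where
  "pos_orthonormal_basis t n \<longleftrightarrow>
     norm t = 1 \<and> norm n = 1 \<and> t \<bullet> n = 0 \<and> det (vector [t, n] :: real^2^2) > 0"

definition unit_normal :: "(real \<Rightarrow> real^2) \<Rightarrow> real \<Rightarrow> real^2" where
  "unit_normal \<gamma> s = (THE n. pos_orthonormal_basis (unit_tangent \<gamma> s) n)"

text \<open>A \<open>C\<^sup>2\<close> piece of a \<open>C\<^sup>1\<close> curve: the second derivative is continuous up to the
  endpoints of \<open>[a, b]\<close>, where it is one-sided.\<close>

definition C2_piece :: "(real \<Rightarrow> real^2) \<Rightarrow> real \<Rightarrow> real \<Rightarrow> bool" where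
  "C2_piece \<gamma> a b \<longleftrightarrow> a < b \<and>
     (\<exists>k. continuous_on {a..b} k \<and>
          (\<forall>s\<in>{a..b}. (unit_tangent \<gamma> has_vector_derivative k s) (at s within {a..b})))"

definition piecewise_C2 :: "real \<Rightarrow> (real \<Rightarrow> real^2) \<Rightarrow> bool" where
  "piecewise_C2 L \<gamma> \<longleftrightarrow>
     (\<exists>(m::nat) a. a 0 = 0 \<and> a m = L \<and> (\<forall>i<m. C2_piece \<gamma> (a i) (a (Suc i))))"

definition has_curvature :: "(real \<Rightarrow> real^2) \<Rightarrow> (real^2 \<Rightarrow> real) \<Rightarrow> bool" where
  "has_curvature \<gamma> H \<longleftrightarrow>
     (\<forall>a b. C2_piece \<gamma> a b \<longrightarrow>
        (\<forall>s\<in>{a..b}. (unit_tangent \<gamma> has_vector_derivative H (\<gamma> s) *\<^sub>R unit_normal \<gamma> s)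
                      (at s within {a..b})))"

lemma pos_orthonormal_basis_iff:
  assumes "norm t = 1"
  shows "pos_orthonormal_basis t n \<longleftrightarrow> n = vector [- t$2, t$1]"
proof -
  have t: "t$1 * t$1 + t$2 * t$2 = 1"
    using assms by (simp add: norm_eq_1 inner_vec_def sum_2)
  show ?thesis
  proof
    assume "pos_orthonormal_basis t n"
    then have n: "n$1 * n$1 + n$2 * n$2 = 1" and o: "t$1 * n$1 + t$2 * n$2 = 0"
      and d: "t$1 * n$2 - t$2 * n$1 > 0"
      by (auto simp: pos_orthonormal_basis_def norm_eq_1 inner_vec_def sum_2 det_2)
    define D where "D = t$1 * n$2 - t$2 * n$1"
    have "D * D = (t$1 * t$1 + t$2 * t$2) * (n$1 * n$1 + n$2 * n$2) - (t$1 * n$1 + t$2 * n$2)^2"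
      unfolding D_def by (simp add: algebra_simps power2_eq_square)
    then have "D^2 = 1"
      using t n o by (simp add: power2_eq_square)
    then have D1: "D = 1"
      using d D_def by (simp add: power2_eq_1_iff)
    have "n$1 = (t$1 * t$1 + t$2 * t$2) * n$1"
      using t by simp
    also have "\<dots> = t$1 * (t$1 * n$1 + t$2 * n$2) - t$2 * D"
      unfolding D_def by (simp add: algebra_simps)
    also have "\<dots> = - t$2"
      unfolding o D1 by simp
    finally have n1: "n$1 = - t$2" .
    have "n$2 = (t$1 * t$1 + t$2 * t$2) * n$2"
      using t by simp
    also have "\<dots> = t$2 * (t$1 * n$1 + t$2 * n$2) + t$1 * D"
      unfolding D_def by (simp add: algebra_simps)
    also have "\<dots> = t$1"
      unfolding o D1 by simp
    finally have n2: "n$2 = t$1" .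
    show "n = vector [- t$2, t$1]"
      using n1 n2 by (simp add: vec_eq_iff forall_2)
  next
    assume "n = vector [- t$2, t$1]"
    then show "pos_orthonormal_basis t n"
      using t assms
      by (simp add: pos_orthonormal_basis_def norm_eq_1 inner_vec_def sum_2 det_2 algebra_simps)
  qed
qed

lemma unit_normal_eq:
  assumes "norm (unit_tangent \<gamma> s) = 1"
  shows "unit_normal \<gamma> s = vector [- unit_tangent \<gamma> s $ 2, unit_tangent \<gamma> s $ 1]"
  unfolding unit_normal_def pos_orthonormal_basis_iff[OF assms] by simp

end

theory Submission
  imports Defs
begin

text \<open>
  Rotate coordinates so that \<open>H\<close> increases in the vertical direction, and let \<open>u = sin \<theta>\<close> be the
  vertical component of the unit tangent; along the curve \<open>du = H dx\<close>. More generally, consider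
  closed curves made of finitely many pieces of the given one and call a corner good if \<open>u\<close> does not
  increase there, so that \<open>\<integral> H dx \<ge> 0\<close> over a loop with good corners. If such a loop passes twice
  through a point, it splits there into two loops, and comparing the four values of \<open>u\<close> at that
  point shows that one of the two has good corners again. Descending in the number of double points
  (finite for a shortest smoothly closed loop) yields a simple loop with good corners. At its lowest
  point \<open>u\<close> passes from \<open>\<le> 0\<close> to \<open>\<ge> 0\<close>, so a good corner there is no corner at all, and positive
  curvature makes the loop run to the right: it is positively oriented. Hence on every vertical line
  the signed crossings sum up to \<open>0\<close> or \<open>1\<close> from below, and as \<open>H\<close> increases upwards,
  \<open>\<integral> H dx < 0\<close>, a contradiction.
\<close>

section \<open>Trajectories with prescribed curvature\<close>

text \<open>A simple subloop of the curve is easy to find, but its one corner may have the wrong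
  sign; then the rest of the curve has to be kept instead, and it has a corner too. The descent
  therefore runs in a class of loops closed under both choices, with any number of corners and
  control of their sign only. Comparing values at a double point would work for either sign; the one
  chosen makes the integral nonnegative and also smooths the lowest point. Double points with equal
  tangents could accumulate, as on a curve run through twice. \<open>H\<close> is merely continuous
  in this part, so uniqueness for the differential equation is not at hand. A shortest smoothly
  closed loop takes its place: its two ends form its only double point with equal tangents, and all
  the others are isolated. The gradient condition says nothing about a single vertical line, which
  may lie in the exceptional null set; averaging over balls turns it into statements about
  \<open>H\<close> itself.\<close>

lemma strict_local_min_second_derivative:
  fixes g g' :: "real \<Rightarrow> real"
  assumes g: "\<And>s. (g has_real_derivative g' s) (at s)"
    and g': "(g' has_real_derivative D) (at a)" and "g' a = 0" "D > 0"
  shows "\<exists>\<epsilon>>0. \<forall>s. s \<noteq> a \<longrightarrow> \<bar>s - a\<bar> < \<epsilon> \<longrightarrow> g a < g s"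
proof -
  obtain d1 where d1: "d1 > 0" "\<And>h. h > 0 \<Longrightarrow> h < d1 \<Longrightarrow> g' a < g' (a + h)"
    using DERIV_pos_inc_right[OF g' \<open>D > 0\<close>] by blast
  obtain d2 where d2: "d2 > 0" "\<And>h. h > 0 \<Longrightarrow> h < d2 \<Longrightarrow> g' (a - h) < g' a"
    using DERIV_pos_inc_left[OF g' \<open>D > 0\<close>] by blast
  have "g a < g s" if "s \<noteq> a" "\<bar>s - a\<bar> < min d1 d2" for s
  proof (cases "s > a")
    case True
    obtain z where z: "a < z" "z < s" "g s - g a = (s - a) * g' z"
      using MVT2[OF True, of g g'] g by blast
    have "g' z > 0"
      using d1(2)[of "z - a"] z that \<open>g' a = 0\<close> by auto
    then show ?thesis using z True by (smt (verit) mult_pos_pos)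
  next
    case False
    then have "s < a" using that by auto
    obtain z where z: "s < z" "z < a" "g a - g s = (a - s) * g' z"
      using MVT2[OF \<open>s < a\<close>, of g g'] g by blast
    have "g' z < 0"
      using d2(2)[of "a - z"] z that \<open>g' a = 0\<close> by auto
    then show ?thesis using z \<open>s < a\<close> by (smt (verit) mult_pos_neg)
  qed
  then show ?thesis using d1(1) d2(1) by (intro exI[of _ "min d1 d2"]) auto
qed

lemma DERIV_linear_approx:
  fixes f :: "real \<Rightarrow> real"
  assumes "(f has_real_derivative D) (at a)" "\<eta> > 0"
  shows "\<exists>\<epsilon>>0. \<forall>s. \<bar>s - a\<bar> < \<epsilon> \<longrightarrow> \<bar>f s - f a - D * (s - a)\<bar> \<le> \<eta> * \<bar>s - a\<bar>"
  using assms unfolding has_field_derivative_def has_derivative_at_alt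
  by (auto simp: real_norm_def)

text \<open>\<open>\<i> * V s\<close> is the tangent turned left by a right angle.
  \<open>H_mono\<close> and \<open>H_strict\<close> are what the gradient condition becomes: the
  difference of \<open>H\<close> between two heights is nonnegative and not identically zero over
  any interval, so by continuity its integral there is positive.\<close>

locale curvature_flow =
  fixes \<Gamma> V :: "real \<Rightarrow> complex" and H :: "complex \<Rightarrow> real"
  assumes deriv_pos: "(\<Gamma> has_vector_derivative V s) (at s)"
    and deriv_tan: "(V has_vector_derivative H (\<Gamma> s) *\<^sub>R (\<i> * V s)) (at s)"
    and norm_V: "norm (V s) = 1"
    and H_pos: "H z > 0"
    and H_cont: "continuous_on UNIV H"
    and H_mono: "y \<le> y' \<Longrightarrow> H (Complex x y) \<le> H (Complex x y')"
    and H_strict: "x1 < x2 \<Longrightarrow> y1 < y2 \<Longrightarrow> \<exists>x. x1 < x \<and> x < x2 \<and> H (Complex x y1) < H (Complex x y2)"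
begin

lemma deriv_coord:
  "((\<lambda>s. Re (\<Gamma> s)) has_real_derivative Re (V s)) (at s)"
  "((\<lambda>s. Im (\<Gamma> s)) has_real_derivative Im (V s)) (at s)"
  "((\<lambda>s. Re (V s)) has_real_derivative - (H (\<Gamma> s) * Im (V s))) (at s)"
  "((\<lambda>s. Im (V s)) has_real_derivative H (\<Gamma> s) * Re (V s)) (at s)"
  using deriv_pos[of s] deriv_tan[of s] by (auto simp: has_vector_derivative_complex_iff)

lemma V_sq: "Re (V s) ^ 2 + Im (V s) ^ 2 = 1"
  using norm_V[of s] by (metis cmod_power2 one_power2)

lemma cont_\<Gamma>: "continuous_on S \<Gamma>"
  by (meson continuous_at_imp_continuous_on deriv_pos has_vector_derivative_continuous)

lemma cont_V: "continuous_on S V"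
  by (meson continuous_at_imp_continuous_on deriv_tan has_vector_derivative_continuous)

section \<open>Return times and double points\<close>

text \<open>Between two passages through one point each component of the velocity vanishes at some
  time. Where the horizontal one does, \<open>Im V\<close> is 1 or -1; where the vertical one does,
  it is 0. As \<open>Im V\<close> changes at a rate of at most \<open>M\<close>, this takes a time
  of at least \<open>1 / M\<close>.\<close>

lemma return_time_gap:
  "\<exists>\<delta>>0. \<forall>a b. 0 \<le> a \<and> a < b \<and> b \<le> L \<and> \<Gamma> a = \<Gamma> b \<longrightarrow> \<delta> \<le> b - a"
proof -
  have "compact ((\<lambda>s. H (\<Gamma> s)) ` {0..L})"
    by (intro compact_continuous_image continuous_on_compose2[OF H_cont cont_\<Gamma>]) auto
  then obtain M where M: "M > 0" "\<And>s. s \<in> {0..L} \<Longrightarrow> H (\<Gamma> s) \<le> M"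
    by (metis abs_le_D1 bounded_pos compact_imp_bounded imageI real_norm_def)
  have "1 / M \<le> b - a" if ab: "0 \<le> a" "a < b" "b \<le> L" "\<Gamma> a = \<Gamma> b" for a b
  proof -
    obtain p where p: "a < p" "p < b" "Re (V p) = 0"
      using MVT2[OF ab(2) deriv_coord(1)] ab by auto
    obtain q where q: "a < q" "q < b" "Im (V q) = 0"
      using MVT2[OF ab(2) deriv_coord(2)] ab by auto
    have "norm (Im (V p) - Im (V q)) \<le> M * norm (p - q)"
    proof (rule field_differentiable_bound[of "{a..b}" "\<lambda>s. Im (V s)"])
      show "((\<lambda>s. Im (V s)) has_real_derivative H (\<Gamma> s) * Re (V s)) (at s within {a..b})" for s
        using deriv_coord(4) DERIV_subset by blast
      show "norm (H (\<Gamma> s) * Re (V s)) \<le> M" if "s \<in> {a..b}" for s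
      proof -
        have "\<bar>Re (V s)\<bar> \<le> 1" using abs_Re_le_cmod[of "V s"] norm_V by simp
        then show ?thesis using M(2)[of s] that ab H_pos[of "\<Gamma> s"]
          using mult_mono[of "H (\<Gamma> s)" M "\<bar>Re (V s)\<bar>" 1] M(1) by (simp add: abs_mult)
      qed
    qed (use p q in auto)
    moreover have "\<bar>Im (V p)\<bar> = 1"
      using V_sq[of p] p by (simp add: power2_eq_1_iff abs_if) linarith
    ultimately have "1 \<le> M * \<bar>p - q\<bar>" using q by simp
    also have "\<dots> \<le> M * (b - a)" using p q M by (intro mult_left_mono) auto
    finally show ?thesis using M by (simp add: field_simps)
  qed
  then show ?thesis using M(1) by (intro exI[of _ "1 / M"]) auto
qed

text \<open>Two branches through a point may cross. They may touch with opposite tangents, and are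
  then separated by the tangent line, because both curve to the left. Or they touch with equal
  tangents, and then progress along the common tangent makes both times move the same way.\<close>

lemma double_points_isolated:
  assumes "\<Gamma> a = \<Gamma> b"
  shows "\<exists>\<epsilon>>0. \<forall>\<sigma> \<tau>. \<bar>\<sigma> - a\<bar> < \<epsilon> \<longrightarrow> \<bar>\<tau> - b\<bar> < \<epsilon> \<longrightarrow> \<Gamma> \<sigma> = \<Gamma> \<tau> \<longrightarrow> (\<sigma>, \<tau>) \<noteq> (a, b) \<longrightarrow>
           V a = V b \<and> (\<sigma> > a \<and> \<tau> > b \<or> \<sigma> < a \<and> \<tau> < b)"
proof -
  \<comment> \<open>Coordinates with origin \<open>\<Gamma> a\<close> along the tangent
    \<open>V a\<close> and along the normal there; \<open>f' b\<close> and \<open>g' b\<close> are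
    the cosine and the sine of the angle from \<open>V a\<close> to \<open>V b\<close>.\<close>
  define f where "f s = Re (V a) * (Re (\<Gamma> s) - Re (\<Gamma> a)) + Im (V a) * (Im (\<Gamma> s) - Im (\<Gamma> a))" for s
  define g where "g s = Re (V a) * (Im (\<Gamma> s) - Im (\<Gamma> a)) - Im (V a) * (Re (\<Gamma> s) - Re (\<Gamma> a))" for s
  define f' where "f' s = Re (V a) * Re (V s) + Im (V a) * Im (V s)" for s
  define g' where "g' s = Re (V a) * Im (V s) - Im (V a) * Re (V s)" for s
  have df: "(f has_real_derivative f' s) (at s)" for s
    unfolding f_def f'_def by (rule DERIV_cong, (rule deriv_coord derivative_intros)+, simp)
  have dg: "(g has_real_derivative g' s) (at s)" for s
    unfolding g_def g'_def by (rule DERIV_cong, (rule deriv_coord derivative_intros)+, simp)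
  have dg': "(g' has_real_derivative H (\<Gamma> s) * f' s) (at s)" for s
    unfolding g'_def f'_def
    by (rule DERIV_cong, (rule deriv_coord derivative_intros)+, simp add: algebra_simps)
  have at_a: "f' a = 1" "g' a = 0"
    using V_sq[of a] by (auto simp: f'_def g'_def power2_eq_square)
  have zero: "f a = 0" "g a = 0" "f b = 0" "g b = 0"
    using assms by (auto simp: f_def g_def)
  have "(f' b)\<^sup>2 + (g' b)\<^sup>2 = ((Re (V a))\<^sup>2 + (Im (V a))\<^sup>2) * ((Re (V b))\<^sup>2 + (Im (V b))\<^sup>2)"
    unfolding f'_def g'_def by (simp add: power2_eq_square algebra_simps)
  then have unit: "(f' b)\<^sup>2 + (g' b)\<^sup>2 = 1"
    by (simp add: V_sq)
  have same: "f \<sigma> = f \<tau> \<and> g \<sigma> = g \<tau>" if "\<Gamma> \<sigma> = \<Gamma> \<tau>" for \<sigma> \<tau>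
    using that by (simp add: f_def g_def)
  consider (trans) "g' b \<noteq> 0" | (same) "g' b = 0" "f' b = 1" | (opp) "g' b = 0" "f' b = -1"
    using unit power2_eq_1_iff[of "f' b"] by fastforce
  then show ?thesis
  proof cases
    case trans
    \<comment> \<open>A quarter of the sine of the crossing angle. For the distances
      \<open>A\<close>, \<open>B\<close> of the two times from \<open>a\<close>, \<open>b\<close>
      the linear approximations then give \<open>3 / 4 * A \<le> 5 / 4 * B\<close> from
      \<open>f\<close> and \<open>3 * B \<le> A\<close> from \<open>g\<close>, so both are
      0.\<close>
    define \<eta> where "\<eta> = \<bar>g' b\<bar> / 4"
    have "(f' b)\<^sup>2 \<le> 1" "(g' b)\<^sup>2 \<le> 1"
      using unit zero_le_power2[of "f' b"] zero_le_power2[of "g' b"] by linarith+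
    then have \<eta>: "\<eta> > 0" "\<eta> \<le> 1 / 4" and f'b: "\<bar>f' b\<bar> \<le> 1"
      using trans unfolding \<eta>_def by (auto simp: abs_square_le_1)
    obtain e1 where e1: "e1 > 0" "\<And>s. \<bar>s - a\<bar> < e1 \<Longrightarrow> \<bar>f s - 1 * (s - a)\<bar> \<le> \<eta> * \<bar>s - a\<bar>"
      using DERIV_linear_approx[OF df \<eta>(1), of a] zero at_a by auto
    obtain e2 where e2: "e2 > 0" "\<And>s. \<bar>s - a\<bar> < e2 \<Longrightarrow> \<bar>g s\<bar> \<le> \<eta> * \<bar>s - a\<bar>"
      using DERIV_linear_approx[OF dg \<eta>(1), of a] zero at_a by auto
    obtain e3 where e3: "e3 > 0" "\<And>s. \<bar>s - b\<bar> < e3 \<Longrightarrow> \<bar>f s - f' b * (s - b)\<bar> \<le> \<eta> * \<bar>s - b\<bar>"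
      using DERIV_linear_approx[OF df \<eta>(1), of b] zero by auto
    obtain e4 where e4: "e4 > 0" "\<And>s. \<bar>s - b\<bar> < e4 \<Longrightarrow> \<bar>g s - g' b * (s - b)\<bar> \<le> \<eta> * \<bar>s - b\<bar>"
      using DERIV_linear_approx[OF dg \<eta>(1), of b] zero by auto
    have False if lt: "\<bar>\<sigma> - a\<bar> < min (min e1 e2) (min e3 e4)" "\<bar>\<tau> - b\<bar> < min (min e1 e2) (min e3 e4)"
      and eq: "\<Gamma> \<sigma> = \<Gamma> \<tau>" and ne: "(\<sigma>, \<tau>) \<noteq> (a, b)" for \<sigma> \<tau>
    proof -
      let ?A = "\<bar>\<sigma> - a\<bar>" and ?B = "\<bar>\<tau> - b\<bar>"
      have 1: "\<bar>f \<sigma> - 1 * (\<sigma> - a)\<bar> \<le> \<eta> * ?A" "\<bar>g \<sigma>\<bar> \<le> \<eta> * ?A"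
        "\<bar>f \<sigma> - f' b * (\<tau> - b)\<bar> \<le> \<eta> * ?B" "\<bar>g \<sigma> - g' b * (\<tau> - b)\<bar> \<le> \<eta> * ?B"
        using e1(2)[of \<sigma>] e2(2)[of \<sigma>] e3(2)[of \<tau>] e4(2)[of \<tau>] lt same[OF eq] by auto
      have "\<bar>f' b * (\<tau> - b)\<bar> \<le> ?B"
        using f'b by (simp add: abs_mult mult_left_le_one_le)
      moreover have "\<eta> * ?A \<le> ?A / 4" "\<eta> * ?B \<le> ?B / 4"
        using \<eta> mult_right_mono[of \<eta> "1/4"] by auto
      ultimately have "3 / 4 * ?A \<le> 5 / 4 * ?B"
        using 1(1) abs_triangle_ineq2[of "f \<sigma>" "f' b * (\<tau> - b)"] 1(3)
          abs_triangle_ineq2[of "\<sigma> - a" "f \<sigma>"] by (simp add: abs_minus_commute)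
      moreover have "\<bar>g' b * (\<tau> - b)\<bar> = 4 * \<eta> * ?B"
        by (simp add: abs_mult \<eta>_def)
      then have "4 * \<eta> * ?B \<le> \<eta> * ?A + \<eta> * ?B"
        using 1(2,4) abs_triangle_ineq2[of "g' b * (\<tau> - b)" "g \<sigma>"] by (simp add: abs_minus_commute)
      then have "\<eta> * (3 * ?B) \<le> \<eta> * ?A" by (simp add: algebra_simps)
      then have "3 * ?B \<le> ?A" using \<eta>(1) by simp
      moreover have "A = 0 \<and> B = 0" if "3 / 4 * A \<le> 5 / 4 * B" "3 * B \<le> A" "0 \<le> A" "0 \<le> B" for A B :: real
        using that by linarith
      ultimately have "?A = 0 \<and> ?B = 0" using abs_ge_zero by blast
      then show False using ne by simp
    qed
    then show ?thesis using e1(1) e2(1) e3(1) e4(1)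
      by (intro exI[of _ "min (min e1 e2) (min e3 e4)"]) auto
  next
    case same
    have "V b = V a * (cnj (V a) * V b)"
      using norm_V[of a] by (simp add: mult.assoc[symmetric] complex_norm_square[symmetric])
    also have "cnj (V a) * V b = 1"
      using same by (simp add: complex_eq_iff f'_def g'_def algebra_simps)
    finally have V: "V a = V b" by simp
    have h: "(0::real) < 1 / 2" by simp
    obtain e1 where e1: "e1 > 0" "\<And>s. \<bar>s - a\<bar> < e1 \<Longrightarrow> \<bar>f s - 1 * (s - a)\<bar> \<le> 1 / 2 * \<bar>s - a\<bar>"
      using DERIV_linear_approx[OF df h, of a] zero at_a by auto
    obtain e2 where e2: "e2 > 0" "\<And>s. \<bar>s - b\<bar> < e2 \<Longrightarrow> \<bar>f s - 1 * (s - b)\<bar> \<le> 1 / 2 * \<bar>s - b\<bar>"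
      using DERIV_linear_approx[OF df h, of b] zero same by auto
    have "\<sigma> > a \<and> \<tau> > b \<or> \<sigma> < a \<and> \<tau> < b" if lt: "\<bar>\<sigma> - a\<bar> < min e1 e2" "\<bar>\<tau> - b\<bar> < min e1 e2"
      and eq: "\<Gamma> \<sigma> = \<Gamma> \<tau>" and ne: "(\<sigma>, \<tau>) \<noteq> (a, b)" for \<sigma> \<tau>
    proof -
      have "\<bar>f \<sigma> - 1 * (\<sigma> - a)\<bar> \<le> 1 / 2 * \<bar>\<sigma> - a\<bar>" "\<bar>f \<sigma> - 1 * (\<tau> - b)\<bar> \<le> 1 / 2 * \<bar>\<tau> - b\<bar>"
        using e1(2)[of \<sigma>] e2(2)[of \<tau>] lt \<open>\<And>\<sigma> \<tau>. \<Gamma> \<sigma> = \<Gamma> \<tau> \<Longrightarrow> f \<sigma> = f \<tau> \<and> g \<sigma> = g \<tau>\<close>[OF eq] by auto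
      then show ?thesis using ne by (auto simp: abs_if split: if_splits)
    qed
    then show ?thesis using e1(1) e2(1) V by (intro exI[of _ "min e1 e2"]) auto
  next
    case opp
    obtain e1 where e1: "e1 > 0" "\<And>s. s \<noteq> a \<Longrightarrow> \<bar>s - a\<bar> < e1 \<Longrightarrow> g a < g s"
      using strict_local_min_second_derivative[OF dg dg' at_a(2)] H_pos at_a(1) by auto
    have "\<exists>\<epsilon>>0. \<forall>s. s \<noteq> b \<longrightarrow> \<bar>s - b\<bar> < \<epsilon> \<longrightarrow> - g b < - g s"
    proof (rule strict_local_min_second_derivative)
      show "((\<lambda>s. - g s) has_real_derivative - g' s) (at s)" for s
        by (intro derivative_intros dg)
      show "((\<lambda>s. - g' s) has_real_derivative - (H (\<Gamma> b) * f' b)) (at b)"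
        by (intro derivative_intros dg')
    qed (use opp H_pos in auto)
    then obtain e2 where e2: "e2 > 0" "\<And>s. s \<noteq> b \<Longrightarrow> \<bar>s - b\<bar> < e2 \<Longrightarrow> g s < g b"
      by auto
    have False if lt: "\<bar>\<sigma> - a\<bar> < min e1 e2" "\<bar>\<tau> - b\<bar> < min e1 e2"
      and eq: "\<Gamma> \<sigma> = \<Gamma> \<tau>" and ne: "(\<sigma>, \<tau>) \<noteq> (a, b)" for \<sigma> \<tau>
      using e1(2)[of \<sigma>] e2(2)[of \<tau>] lt same[OF eq] ne zero by fastforce
    then show ?thesis using e1(1) e2(1) by (intro exI[of _ "min e1 e2"]) auto
  qed
qed

lemma shortest_smooth_loop:
  assumes "L > 0" "\<Gamma> L = \<Gamma> 0" "V L = V 0"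
  obtains s t where "0 \<le> s" "s < t" "t \<le> L" "\<Gamma> s = \<Gamma> t" "V s = V t"
    "\<And>\<sigma> \<tau>. s \<le> \<sigma> \<Longrightarrow> \<sigma> < \<tau> \<Longrightarrow> \<tau> \<le> t \<Longrightarrow> \<Gamma> \<sigma> = \<Gamma> \<tau> \<Longrightarrow> V \<sigma> = V \<tau> \<Longrightarrow> \<sigma> = s \<and> \<tau> = t"
proof -
  obtain \<delta> where \<delta>: "\<delta> > 0" "\<And>a b. 0 \<le> a \<Longrightarrow> a < b \<Longrightarrow> b \<le> L \<Longrightarrow> \<Gamma> a = \<Gamma> b \<Longrightarrow> \<delta> \<le> b - a"
    using return_time_gap by blast
  \<comment> \<open>The gap \<delta> replaces the strict inequality between the two times, so that
    \<open>S\<close> is compact and a shortest duration is attained.\<close>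
  define S where "S = ({0..L} \<times> {0..L}) \<inter> ({z. fst z + \<delta> \<le> snd z} \<inter>
      ({z. \<Gamma> (fst z) = \<Gamma> (snd z)} \<inter> {z. V (fst z) = V (snd z)}))"
  have "compact S" unfolding S_def
    by (intro compact_Int_closed compact_Times closed_Int closed_Collect_le closed_Collect_eq
        continuous_intros continuous_on_compose2[OF cont_\<Gamma>] continuous_on_compose2[OF cont_V]) auto
  moreover have "(0, L) \<in> S" using assms \<delta>(2)[of 0 L] by (auto simp: S_def)
  moreover have "continuous_on S (\<lambda>z. snd z - fst z)"
    by (intro continuous_intros)
  ultimately obtain z where z: "z \<in> S" "\<And>w. w \<in> S \<Longrightarrow> snd z - fst z \<le> snd w - fst w"
    using continuous_attains_inf[of S "\<lambda>z. snd z - fst z"]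
    by blast
  show thesis
  proof (rule that[of "fst z" "snd z"])
    fix \<sigma> \<tau> assume *: "fst z \<le> \<sigma>" "\<sigma> < \<tau>" "\<tau> \<le> snd z" "\<Gamma> \<sigma> = \<Gamma> \<tau>" "V \<sigma> = V \<tau>"
    then have "(\<sigma>, \<tau>) \<in> S" using z(1) \<delta>(2)[of \<sigma> \<tau>] by (auto simp: S_def)
    from z(2)[OF this] show "\<sigma> = fst z \<and> \<tau> = snd z" using * by auto
  qed (use z(1) \<delta>(1) in \<open>auto simp: S_def\<close>)
qed

text \<open>By compactness infinitely many double points accumulate at one of them. It has equal
  tangents by \<open>double_points_isolated\<close>, so it is \<open>(s, t)\<close>; but double
  points close to it have both times later or both earlier, hence one of them outside the
  interval.\<close>

lemma finite_double_points:
  assumes "0 \<le> s" "t \<le> L"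
    and min: "\<And>\<sigma> \<tau>. s \<le> \<sigma> \<Longrightarrow> \<sigma> < \<tau> \<Longrightarrow> \<tau> \<le> t \<Longrightarrow> \<Gamma> \<sigma> = \<Gamma> \<tau> \<Longrightarrow> V \<sigma> = V \<tau> \<Longrightarrow> \<sigma> = s \<and> \<tau> = t"
  shows "finite {(\<sigma>, \<tau>). s \<le> \<sigma> \<and> \<sigma> < \<tau> \<and> \<tau> \<le> t \<and> \<Gamma> \<sigma> = \<Gamma> \<tau>}" (is "finite ?D")
proof (rule ccontr)
  assume inf: "infinite ?D"
  obtain \<delta> where \<delta>: "\<delta> > 0" "\<And>a b. 0 \<le> a \<Longrightarrow> a < b \<Longrightarrow> b \<le> L \<Longrightarrow> \<Gamma> a = \<Gamma> b \<Longrightarrow> \<delta> \<le> b - a"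
    using return_time_gap by blast
  have D_eq: "?D = ({s..t} \<times> {s..t}) \<inter> ({z. fst z + \<delta> \<le> snd z} \<inter> {z. \<Gamma> (fst z) = \<Gamma> (snd z)})"
    using \<delta> assms(1,2) by (force simp: algebra_simps)
  have "compact ?D" unfolding D_eq
    by (intro compact_Int_closed compact_Times closed_Int closed_Collect_le closed_Collect_eq
        continuous_intros continuous_on_compose2[OF cont_\<Gamma>]) auto
  then obtain a b where ab: "(a, b) \<in> ?D" "(a, b) islimpt ?D"
    using Heine_Borel_imp_Bolzano_Weierstrass[OF _ inf order_refl] by auto
  obtain \<epsilon> where \<epsilon>: "\<epsilon> > 0" "\<And>\<sigma> \<tau>. \<bar>\<sigma> - a\<bar> < \<epsilon> \<Longrightarrow> \<bar>\<tau> - b\<bar> < \<epsilon> \<Longrightarrow> \<Gamma> \<sigma> = \<Gamma> \<tau> \<Longrightarrow> (\<sigma>, \<tau>) \<noteq> (a, b) \<Longrightarrow>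
           V a = V b \<and> (\<sigma> > a \<and> \<tau> > b \<or> \<sigma> < a \<and> \<tau> < b)"
    using double_points_isolated[of a b] ab by auto
  obtain \<sigma> \<tau> where st: "(\<sigma>, \<tau>) \<in> ?D" "(\<sigma>, \<tau>) \<noteq> (a, b)" "dist (\<sigma>, \<tau>) (a, b) < \<epsilon>"
    using ab(2) \<epsilon>(1) unfolding islimpt_approachable by fast
  have "\<bar>\<sigma> - a\<bar> < \<epsilon>" "\<bar>\<tau> - b\<bar> < \<epsilon>"
    using st(3) dist_fst_le[of "(\<sigma>, \<tau>)" "(a, b)"] dist_snd_le[of "(\<sigma>, \<tau>)" "(a, b)"]
    by (auto simp: dist_real_def)
  then have "V a = V b" "\<sigma> > a \<and> \<tau> > b \<or> \<sigma> < a \<and> \<tau> < b"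
    using \<epsilon>(2)[of \<sigma> \<tau>] st by auto
  moreover from this(1) have "a = s" "b = t" using min[of a b] ab(1) by auto
  ultimately show False using st(1) by auto
qed

end

section \<open>Loops with good corners\<close>

text \<open>The closing pair \<open>(0, T)\<close> is counted, so a loop is simple if it is the only
  element; for a proper subloop it is the pair that gets lost.\<close>

definition double_points :: "real \<Rightarrow> (real \<Rightarrow> complex) \<Rightarrow> (real \<times> real) set" where
  "double_points T c = {(a, b). 0 \<le> a \<and> a < b \<and> b \<le> T \<and> c a = c b}"

context curvature_flow
begin

text \<open>The curve \<open>c\<close> on \<open>[0, T]\<close> leaves \<open>c r\<close> along \<open>\<Gamma>\<close> as at time \<open>p r\<close> and reaches it as at time
  \<open>m r\<close>. Stating this locally spares a list of pieces; compactness recovers finiteness.\<close>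

definition cornered_loop :: "real \<Rightarrow> (real \<Rightarrow> complex) \<Rightarrow> (real \<Rightarrow> real) \<Rightarrow> (real \<Rightarrow> real) \<Rightarrow> bool" where
  "cornered_loop T c p m \<longleftrightarrow> T > 0 \<and> c 0 = c T \<and>
     (\<forall>r. 0 \<le> r \<and> r < T \<longrightarrow> (\<exists>\<epsilon>>0. \<forall>h. 0 \<le> h \<and> h \<le> \<epsilon> \<longrightarrow> c (r + h) = \<Gamma> (p r + h))) \<and>
     (\<forall>r. 0 < r \<and> r \<le> T \<longrightarrow> (\<exists>\<epsilon>>0. \<forall>h. 0 \<le> h \<and> h \<le> \<epsilon> \<longrightarrow> c (r - h) = \<Gamma> (m r - h))) \<and>
     (\<forall>r. 0 < r \<and> r < T \<longrightarrow> Im (V (p r)) \<le> Im (V (m r))) \<and> Im (V (p 0)) \<le> Im (V (m T))"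

lemma cornered_loopD:
  assumes "cornered_loop T c p m"
  shows "T > 0" "c 0 = c T"
    "\<And>r. 0 \<le> r \<Longrightarrow> r < T \<Longrightarrow> \<exists>\<epsilon>>0. \<forall>h. 0 \<le> h \<and> h \<le> \<epsilon> \<longrightarrow> c (r + h) = \<Gamma> (p r + h)"
    "\<And>r. 0 < r \<Longrightarrow> r \<le> T \<Longrightarrow> \<exists>\<epsilon>>0. \<forall>h. 0 \<le> h \<and> h \<le> \<epsilon> \<longrightarrow> c (r - h) = \<Gamma> (m r - h)"
    "\<And>r. 0 < r \<Longrightarrow> r < T \<Longrightarrow> Im (V (p r)) \<le> Im (V (m r))"
    "Im (V (p 0)) \<le> Im (V (m T))"
  using assms unfolding cornered_loop_def by blast+

section \<open>Splitting a loop at a double point\<close>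

lemma cornered_loop_subloop:
  assumes c: "cornered_loop T c p m" and ab: "0 \<le> \<alpha>" "\<alpha> < \<beta>" "\<beta> \<le> T" "c \<alpha> = c \<beta>"
    and good: "Im (V (p \<alpha>)) \<le> Im (V (m \<beta>))"
  shows "cornered_loop (\<beta> - \<alpha>) (\<lambda>r. c (\<alpha> + r)) (\<lambda>r. p (\<alpha> + r)) (\<lambda>r. m (\<alpha> + r))"
  unfolding cornered_loop_def
proof (intro conjI allI impI)
  fix r assume "0 \<le> r \<and> r < \<beta> - \<alpha>"
  then show "\<exists>\<epsilon>>0. \<forall>h. 0 \<le> h \<and> h \<le> \<epsilon> \<longrightarrow> c (\<alpha> + (r + h)) = \<Gamma> (p (\<alpha> + r) + h)"
    using cornered_loopD(3)[OF c, of "\<alpha> + r"] ab by (simp add: add.assoc)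
next
  fix r assume "0 < r \<and> r \<le> \<beta> - \<alpha>"
  then show "\<exists>\<epsilon>>0. \<forall>h. 0 \<le> h \<and> h \<le> \<epsilon> \<longrightarrow> c (\<alpha> + (r - h)) = \<Gamma> (m (\<alpha> + r) - h)"
    using cornered_loopD(4)[OF c, of "\<alpha> + r"] ab by (simp add: add_diff_eq)
next
  fix r assume "0 < r \<and> r < \<beta> - \<alpha>"
  then show "Im (V (p (\<alpha> + r))) \<le> Im (V (m (\<alpha> + r)))"
    using cornered_loopD(5)[OF c, of "\<alpha> + r"] ab by simp
qed (use ab good in auto)

text \<open>The case distinctions in \<open>p\<close> and \<open>m\<close> differ at
  \<open>r = \<alpha>\<close> on purpose: the new corner is reached as the old loop reached \<alpha>
  and left as it left \<beta>.\<close>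

lemma cornered_loop_excise:
  assumes c: "cornered_loop T c p m" and ab: "0 < \<alpha>" "\<alpha> < \<beta>" "\<beta> < T" "c \<alpha> = c \<beta>"
    and good: "Im (V (p \<beta>)) \<le> Im (V (m \<alpha>))"
  defines "d \<equiv> \<beta> - \<alpha>"
  shows "cornered_loop (T - d) (\<lambda>r. c (if r < \<alpha> then r else r + d))
     (\<lambda>r. p (if r < \<alpha> then r else r + d)) (\<lambda>r. m (if r \<le> \<alpha> then r else r + d))"
  unfolding cornered_loop_def
proof (intro conjI allI impI)
  fix r assume r: "0 \<le> r \<and> r < T - d"
  show "\<exists>\<epsilon>>0. \<forall>h. 0 \<le> h \<and> h \<le> \<epsilon> \<longrightarrow>
     c (if r + h < \<alpha> then r + h else r + h + d) = \<Gamma> (p (if r < \<alpha> then r else r + d) + h)"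
  proof (cases "r < \<alpha>")
    case True
    then obtain \<epsilon> where "\<epsilon> > 0" "\<And>h. 0 \<le> h \<Longrightarrow> h \<le> \<epsilon> \<Longrightarrow> c (r + h) = \<Gamma> (p r + h)"
      using cornered_loopD(3)[OF c, of r] r ab by (auto simp: d_def)
    then show ?thesis using True
      by (intro exI[of _ "min \<epsilon> ((\<alpha> - r) / 2)"]) (auto simp: min_def field_simps split: if_splits)
  next
    case False
    then obtain \<epsilon> where "\<epsilon> > 0" "\<And>h. 0 \<le> h \<Longrightarrow> h \<le> \<epsilon> \<Longrightarrow> c (r + d + h) = \<Gamma> (p (r + d) + h)"
      using cornered_loopD(3)[OF c, of "r + d"] r ab by (auto simp: d_def)
    then show ?thesis using False
      by (intro exI[of _ \<epsilon>]) (auto simp: algebra_simps)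
  qed
next
  fix r assume r: "0 < r \<and> r \<le> T - d"
  show "\<exists>\<epsilon>>0. \<forall>h. 0 \<le> h \<and> h \<le> \<epsilon> \<longrightarrow>
     c (if r - h < \<alpha> then r - h else r - h + d) = \<Gamma> (m (if r \<le> \<alpha> then r else r + d) - h)"
  proof (cases "r \<le> \<alpha>")
    case True
    then obtain \<epsilon> where e: "\<epsilon> > 0" "\<And>h. 0 \<le> h \<Longrightarrow> h \<le> \<epsilon> \<Longrightarrow> c (r - h) = \<Gamma> (m r - h)"
      using cornered_loopD(4)[OF c, of r] r ab by (auto simp: d_def)
    have "c (if r - h < \<alpha> then r - h else r - h + d) = \<Gamma> (m r - h)" if "0 \<le> h" "h \<le> \<epsilon>" for h
    proof (cases "r - h < \<alpha>")
      case False
      \<comment> \<open>Only the corner itself gets here; its time is then read as \<beta>, where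
        the loop is at the same point.\<close>
      then have "r = \<alpha>" "h = 0" using True that by auto
      then show ?thesis using e(2)[of 0] e(1) ab by (simp add: d_def)
    qed (use e(2) that in auto)
    then have "\<forall>h. 0 \<le> h \<and> h \<le> \<epsilon> \<longrightarrow> c (if r - h < \<alpha> then r - h else r - h + d) = \<Gamma> (m r - h)"
      by blast
    then show ?thesis using True e(1) by (simp only: if_True) blast
  next
    case False
    then obtain \<epsilon> where "\<epsilon> > 0" "\<And>h. 0 \<le> h \<Longrightarrow> h \<le> \<epsilon> \<Longrightarrow> c (r + d - h) = \<Gamma> (m (r + d) - h)"
      using cornered_loopD(4)[OF c, of "r + d"] r ab by (auto simp: d_def)
    then show ?thesis using False
      by (intro exI[of _ "min \<epsilon> (r - \<alpha>)"]) (auto simp: algebra_simps)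
  qed
next
  fix r assume r: "0 < r \<and> r < T - d"
  show "Im (V (p (if r < \<alpha> then r else r + d))) \<le> Im (V (m (if r \<le> \<alpha> then r else r + d)))"
    using cornered_loopD(5)[OF c, of r] cornered_loopD(5)[OF c, of "r + d"] good r ab
    by (auto simp: d_def)
qed (use cornered_loopD[OF c] ab in \<open>auto simp: d_def\<close>)

text \<open>Both parts at a double point have fewer double points and are loops of the same kind,
  except for the sign of the new corner. At least one of the two signs is right, and that part
  serves for the induction.\<close>

lemma ex_simple_cornered_loop:
  assumes "cornered_loop T c p m" "finite (double_points T c)"
  shows "\<exists>T c p m. cornered_loop T c p m \<and> double_points T c = {(0, T)}"
  using assms
proof (induction "card (double_points T c)" arbitrary: T c p m rule: less_induct)
  case less
  note c = less.prems(1) and fin = less.prems(2)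
  have whole: "(0, T) \<in> double_points T c"
    using cornered_loopD(1,2)[OF c] by (simp add: double_points_def)
  show ?case
  proof (cases "double_points T c = {(0, T)}")
    case False
    then obtain a b where ab: "0 \<le> a" "a < b" "b \<le> T" "c a = c b" "(a, b) \<noteq> (0, T)"
      using whole by (auto simp: double_points_def)
    have sub: ?thesis if ab: "0 \<le> \<alpha>" "\<alpha> < \<beta>" "\<beta> \<le> T" "c \<alpha> = c \<beta>" "(\<alpha>, \<beta>) \<noteq> (0, T)"
      and good: "Im (V (p \<alpha>)) \<le> Im (V (m \<beta>))" for \<alpha> \<beta>
    proof -
      let ?D = "double_points (\<beta> - \<alpha>) (\<lambda>r. c (\<alpha> + r))"
      let ?f = "\<lambda>(a, b). (\<alpha> + a, \<alpha> + b)"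
      have im: "?f ` ?D \<subseteq> double_points T c - {(0, T)}"
        using ab by (auto simp: double_points_def)
      have inj: "inj_on ?f ?D" by (auto simp: inj_on_def)
      have fin': "finite ?D" using im inj fin by (meson finite_Diff finite_imageD finite_subset)
      have "card ?D = card (?f ` ?D)" using inj by (simp add: card_image)
      also have "\<dots> \<le> card (double_points T c - {(0, T)})" using im fin by (intro card_mono) auto
      also have "\<dots> < card (double_points T c)" using whole fin by (meson card_Diff1_less)
      finally show ?thesis
        using less.hyps cornered_loop_subloop[OF c ab(1-4) good] fin' by blast
    qed
    \<comment> \<open>If one of the two times is \<open>0\<close> or \<open>T\<close>, the other one
      cuts the loop into two subloops that both start at the base point, and nothing has to be
      excised.\<close>
    consider (inner) "0 < a" "b < T" | (base) x where "0 < x" "x < T" "c 0 = c x"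
      using ab cornered_loopD(2)[OF c] by (metis order_le_less order_less_le_trans order_le_less_trans)
    then show ?thesis
    proof cases
      case inner
      show ?thesis
      proof (cases "Im (V (p a)) \<le> Im (V (m b))")
        case True
        then show ?thesis using sub[of a b] ab by auto
      next
        case False
        \<comment> \<open>The values of \<open>Im V\<close> at \<open>p b\<close>,
          \<open>m b\<close>, \<open>p a\<close>, \<open>m a\<close> increase in this order,
          strictly in the middle; the first and the last are those of the corner that excision
          leaves.\<close>
        then have good: "Im (V (p b)) \<le> Im (V (m a))"
          using cornered_loopD(5)[OF c, of a] cornered_loopD(5)[OF c, of b] inner ab by linarith
        define d where "d = b - a"
        define c' where "c' = (\<lambda>r. c (if r < a then r else r + d))"
        have loop: "cornered_loop (T - d) c' (\<lambda>r. p (if r < a then r else r + d)) (\<lambda>r. m (if r \<le> a then r else r + d))"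
          using cornered_loop_excise[OF c inner(1) ab(2) inner(2) ab(4) good] unfolding d_def c'_def .
        let ?D = "double_points (T - d) c'"
        let ?g = "\<lambda>r. if r < a then r else r + d"
        let ?f = "\<lambda>(x, y). (?g x, ?g y)"
        have "d > 0" using ab d_def by simp
        \<comment> \<open>\<open>?g\<close> never takes the value \<open>a\<close>, so the pair
          \<open>(a, b)\<close> is lost.\<close>
        have im: "?f ` ?D \<subseteq> double_points T c - {(a, b)}"
        proof (clarify, intro DiffI)
          fix x y assume "(x, y) \<in> ?D"
          then have xy: "0 \<le> x" "x < y" "y \<le> T - d" "c (?g x) = c (?g y)"
            by (simp_all add: double_points_def c'_def)
          moreover have "0 \<le> ?g x" "?g x < ?g y" "?g y \<le> T"
            using xy(1-3) \<open>d > 0\<close> ab by auto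
          ultimately show "(?g x, ?g y) \<in> double_points T c"
            unfolding double_points_def by blast
          show "(?g x, ?g y) \<notin> {(a, b)}" using \<open>d > 0\<close> by auto
        qed
        have "inj ?g" using \<open>d > 0\<close> by (auto simp: inj_on_def)
        from prod.inj_map[OF this this] have inj: "inj_on ?f ?D"
          unfolding map_prod_def by (rule inj_on_subset) simp
        have fin': "finite ?D" using im inj fin by (meson finite_Diff finite_imageD finite_subset)
        have "card ?D = card (?f ` ?D)" using inj by (simp add: card_image)
        also have "\<dots> \<le> card (double_points T c - {(a, b)})" using im fin by (intro card_mono) auto
        also have "\<dots> < card (double_points T c)"
          using ab fin by (intro card_Diff1_less) (simp_all add: double_points_def)
        finally show ?thesis
          using less.hyps loop fin' by blast
      qed
    next
      case base
      show ?thesis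
      proof (cases "Im (V (p 0)) \<le> Im (V (m x))")
        case True
        then show ?thesis using sub[of 0 x] base by auto
      next
        case False
        then have "Im (V (p x)) \<le> Im (V (m T))"
          using cornered_loopD(5,6)[OF c] base by (meson linear order_trans)
        then show ?thesis using sub[of x T] base cornered_loopD(2)[OF c] by auto
      qed
    qed
  qed (use c in blast)
qed

lemma smooth_loop_cornered:
  assumes "s < t" "\<Gamma> s = \<Gamma> t" "V s = V t"
  shows "cornered_loop (t - s) (\<lambda>r. \<Gamma> (s + r)) ((+) s) ((+) s)"
  unfolding cornered_loop_def using assms
  by (auto intro!: exI[of _ "1::real"] simp: algebra_simps)

lemma ex_simple_cornered_loop_of_closed:
  assumes "L > 0" "\<Gamma> L = \<Gamma> 0" "V L = V 0"
  shows "\<exists>T c p m. cornered_loop T c p m \<and> double_points T c = {(0, T)}"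
proof -
  obtain s t where st: "0 \<le> s" "s < t" "t \<le> L" "\<Gamma> s = \<Gamma> t" "V s = V t"
    "\<And>\<sigma> \<tau>. s \<le> \<sigma> \<Longrightarrow> \<sigma> < \<tau> \<Longrightarrow> \<tau> \<le> t \<Longrightarrow> \<Gamma> \<sigma> = \<Gamma> \<tau> \<Longrightarrow> V \<sigma> = V \<tau> \<Longrightarrow> \<sigma> = s \<and> \<tau> = t"
    using shortest_smooth_loop[OF assms] by metis
  let ?f = "\<lambda>(a, b). (s + a, s + b)"
  have "?f ` double_points (t - s) (\<lambda>r. \<Gamma> (s + r)) \<subseteq>
      {(\<sigma>, \<tau>). s \<le> \<sigma> \<and> \<sigma> < \<tau> \<and> \<tau> \<le> t \<and> \<Gamma> \<sigma> = \<Gamma> \<tau>}"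
    by (auto simp: double_points_def)
  moreover have "inj_on ?f (double_points (t - s) (\<lambda>r. \<Gamma> (s + r)))" by (auto simp: inj_on_def)
  moreover have "finite {(\<sigma>, \<tau>). s \<le> \<sigma> \<and> \<sigma> < \<tau> \<and> \<tau> \<le> t \<and> \<Gamma> \<sigma> = \<Gamma> \<tau>}"
    by (rule finite_double_points[OF st(1,3)]) (use st(6) in blast)
  ultimately have "finite (double_points (t - s) (\<lambda>r. \<Gamma> (s + r)))"
    by (meson finite_imageD finite_subset)
  then show ?thesis
    using ex_simple_cornered_loop smooth_loop_cornered[OF st(2,4,5)] by blast
qed

end

section \<open>Decomposition into graphs\<close>

lemma eventually_sign_right:
  fixes f :: "real \<Rightarrow> real"
  assumes D: "(f has_real_derivative D) (at 0)" and nz: "f 0 \<noteq> 0 \<or> D \<noteq> 0"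
  shows "\<exists>\<sigma>. (\<sigma> = 1 \<or> \<sigma> = -1) \<and> (\<exists>\<epsilon>>0. \<forall>h. 0 < h \<and> h < \<epsilon> \<longrightarrow> \<sigma> * f h > 0)"
proof -
  have pos: "\<exists>\<epsilon>>0. \<forall>h. 0 < h \<and> h < \<epsilon> \<longrightarrow> g h > 0"
    if D: "(g has_real_derivative E) (at 0)" and "g 0 > 0 \<or> g 0 = 0 \<and> E > 0" for g :: "real \<Rightarrow> real" and E
    using that(2)
  proof
    assume "g 0 > 0"
    then have "\<forall>\<^sub>F x in nhds 0. g x > 0"
      using DERIV_isCont[OF D] by (intro order_tendstoD) (auto simp: isCont_def tendsto_at_iff_tendsto_nhds)
    then show ?thesis by (auto simp: eventually_nhds_metric dist_real_def)
  next
    assume "g 0 = 0 \<and> E > 0"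
    then show ?thesis using DERIV_pos_inc_right[OF D] by auto
  qed
  consider "f 0 > 0 \<or> f 0 = 0 \<and> D > 0" | "- f 0 > 0 \<or> - f 0 = 0 \<and> - D > 0"
    using nz by linarith
  then show ?thesis
  proof cases
    case 1
    then show ?thesis using pos[OF D] by (intro exI[of _ 1]) auto
  next
    case 2
    then show ?thesis using pos[OF DERIV_minus[OF D]] by (intro exI[of _ "-1"]) auto
  qed
qed

lemma strict_mono_image_atLeastAtMost:
  fixes f :: "real \<Rightarrow> real"
  assumes "a \<le> b" "continuous_on {a..b} f" "\<And>x y. a \<le> x \<Longrightarrow> x < y \<Longrightarrow> y \<le> b \<Longrightarrow> f x < f y"
  shows "f ` {a..b} = {f a..f b}"
proof
  show "f ` {a..b} \<subseteq> {f a..f b}"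
    using assms(3) by (fastforce simp: order_le_less)
  show "{f a..f b} \<subseteq> f ` {a..b}"
    using IVT'[OF _ _ assms(1,2)] by fastforce
qed

text \<open>For a piece that is a graph over a horizontal interval, \<open>wt\<close> is \<open>1\<close> or \<open>-1\<close> over the interval (closed
  on the left, open on the right) according to the direction of travel, and \<open>0\<close> elsewhere. Outside the interval
  \<open>ht\<close> is junk.\<close>

definition wt :: "(real \<Rightarrow> complex) \<Rightarrow> real \<Rightarrow> real \<Rightarrow> real \<Rightarrow> real" where
  "wt c a b x = of_bool (x < Re (c b)) - of_bool (x < Re (c a))"

definition ht :: "(real \<Rightarrow> complex) \<Rightarrow> real \<Rightarrow> real \<Rightarrow> real \<Rightarrow> real" where
  "ht c a b x = Im (c (the_inv_into {a..b} (\<lambda>r. Re (c r)) x))"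

definition x_range :: "(real \<Rightarrow> complex) \<Rightarrow> real \<Rightarrow> real \<Rightarrow> real set" where
  "x_range c a b = {min (Re (c a)) (Re (c b))..max (Re (c a)) (Re (c b))}"

context curvature_flow
begin

text \<open>A loop fixes \<open>p r\<close> and \<open>m r\<close> only through the germ of the
  curve there, and several times may fit. One-sided derivatives show that the tangent does not
  depend on the choice.\<close>

lemma V_eq_of_right_germ:
  assumes "\<epsilon> > 0" "\<And>h. 0 \<le> h \<Longrightarrow> h \<le> \<epsilon> \<Longrightarrow> \<Gamma> (s + h) = \<Gamma> (s' + h)"
  shows "V s = V s'"
proof -
  have d: "((\<lambda>h. \<Gamma> (u + h)) has_vector_derivative V u) (at 0 within {0..\<epsilon>})" for u
  proof -
    have "((\<Gamma> \<circ> (+) u) has_vector_derivative 1 *\<^sub>R V (u + 0)) (at 0)"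
      by (rule vector_diff_chain_at) (auto intro!: derivative_eq_intros deriv_pos)
    then show ?thesis by (auto simp: o_def intro: has_vector_derivative_at_within)
  qed
  have "((\<lambda>h. \<Gamma> (s + h)) has_vector_derivative V s') (at 0 within {0..\<epsilon>})"
    by (rule has_vector_derivative_transform[OF _ _ d]) (use assms in auto)
  then show ?thesis
    using vector_derivative_unique_within_closed_interval[of 0 \<epsilon> 0, unfolded cbox_interval, OF _ _ d] assms(1) by auto
qed

lemma V_eq_of_left_germ:
  assumes "\<epsilon> > 0" "\<And>h. 0 \<le> h \<Longrightarrow> h \<le> \<epsilon> \<Longrightarrow> \<Gamma> (s - h) = \<Gamma> (s' - h)"
  shows "V s = V s'"
proof -
  have d: "((\<lambda>h. \<Gamma> (u - h)) has_vector_derivative - V u) (at 0 within {0..\<epsilon>})" for u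
  proof -
    have "((\<Gamma> \<circ> (-) u) has_vector_derivative (-1) *\<^sub>R V (u - 0)) (at 0)"
      by (rule vector_diff_chain_at) (auto intro!: derivative_eq_intros deriv_pos)
    then show ?thesis by (auto simp: o_def intro: has_vector_derivative_at_within)
  qed
  have "((\<lambda>h. \<Gamma> (s - h)) has_vector_derivative - V s') (at 0 within {0..\<epsilon>})"
    by (rule has_vector_derivative_transform[OF _ _ d]) (use assms in auto)
  then have "- V s = - V s'"
    using vector_derivative_unique_within_closed_interval[of 0 \<epsilon> 0, unfolded cbox_interval, OF _ _ d] assms(1) by auto
  then show ?thesis by simp
qed

text \<open>The sign is prescribed on the open interval only, since pieces have to end at vertical
  tangents. One shift \<open>u\<close> serves for the whole interval, so that no corner lies
  inside.\<close>

definition graph_piece :: "(real \<Rightarrow> complex) \<Rightarrow> real \<Rightarrow> real \<Rightarrow> bool" where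
  "graph_piece c a b \<longleftrightarrow> a < b \<and> (\<exists>u \<sigma>. (\<sigma> = 1 \<or> \<sigma> = -1) \<and>
     (\<forall>r\<in>{a..b}. c r = \<Gamma> (u + r)) \<and> (\<forall>r\<in>{a<..<b}. \<sigma> * Re (V (u + r)) > 0))"

section \<open>Cutting at corners and vertical tangents\<close>

text \<open>Vertical tangents are isolated: where \<open>Re V\<close> vanishes, \<open>Im V\<close>
  does not, and neither does the derivative of \<open>Re V\<close>, because \<open>H\<close> is
  positive.\<close>

lemma Re_V_sign:
  "\<exists>\<sigma>. (\<sigma> = 1 \<or> \<sigma> = -1) \<and> (\<exists>\<epsilon>>0. \<forall>h. 0 < h \<and> h < \<epsilon> \<longrightarrow> \<sigma> * Re (V (s + h)) > 0)"
  "\<exists>\<sigma>. (\<sigma> = 1 \<or> \<sigma> = -1) \<and> (\<exists>\<epsilon>>0. \<forall>h. 0 < h \<and> h < \<epsilon> \<longrightarrow> \<sigma> * Re (V (s - h)) > 0)"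
proof -
  let ?D = "- (H (\<Gamma> s) * Im (V s))"
  have nz: "Re (V s) \<noteq> 0 \<or> ?D \<noteq> 0"
    using V_sq[of s] H_pos[of "\<Gamma> s"] by auto
  have "((\<lambda>h. Re (V (s + h))) has_real_derivative ?D) (at 0)"
    using deriv_coord(3)[of s] DERIV_shift[of "\<lambda>x. Re (V x)" _ 0 s] by (simp add: add.commute)
  then show "\<exists>\<sigma>. (\<sigma> = 1 \<or> \<sigma> = -1) \<and> (\<exists>\<epsilon>>0. \<forall>h. 0 < h \<and> h < \<epsilon> \<longrightarrow> \<sigma> * Re (V (s + h)) > 0)"
    by (rule eventually_sign_right) (use nz in auto)
  have "((\<lambda>h. Re (V (s - h))) has_real_derivative ?D * (0 - 1)) (at 0)"
    by (rule DERIV_chain2[where g = "\<lambda>h. s - h"]) (auto intro!: derivative_eq_intros deriv_coord)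
  then show "\<exists>\<sigma>. (\<sigma> = 1 \<or> \<sigma> = -1) \<and> (\<exists>\<epsilon>>0. \<forall>h. 0 < h \<and> h < \<epsilon> \<longrightarrow> \<sigma> * Re (V (s - h)) > 0)"
    by (rule eventually_sign_right) (use nz in auto)
qed

lemma graph_piece_right:
  assumes "cornered_loop T c p m" "0 \<le> r" "r < T"
  shows "\<exists>d>0. \<forall>b. r < b \<and> b < r + d \<longrightarrow> graph_piece c r b"
proof -
  obtain e1 where e1: "e1 > 0" "\<And>h. 0 \<le> h \<Longrightarrow> h \<le> e1 \<Longrightarrow> c (r + h) = \<Gamma> (p r + h)"
    using cornered_loopD(3)[OF assms] by auto
  obtain \<sigma> e2 where e2: "\<sigma> = 1 \<or> \<sigma> = -1" "e2 > 0" "\<And>h. 0 < h \<Longrightarrow> h < e2 \<Longrightarrow> \<sigma> * Re (V (p r + h)) > 0"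
    using Re_V_sign(1)[of "p r"] by metis
  have "graph_piece c r b" if b: "r < b" "b < r + min e1 e2" for b
  proof -
    have "c x = \<Gamma> (p r - r + x)" if "x \<in> {r..b}" for x
      using e1(2)[of "x - r"] that b by (auto simp: algebra_simps)
    moreover have "\<sigma> * Re (V (p r - r + x)) > 0" if "x \<in> {r<..<b}" for x
      using e2(3)[of "x - r"] that b by (auto simp: algebra_simps)
    ultimately show ?thesis
      unfolding graph_piece_def using b(1) e2(1) by blast
  qed
  then show ?thesis using e1(1) e2(2) by (intro exI[of _ "min e1 e2"]) auto
qed

lemma graph_piece_left:
  assumes "cornered_loop T c p m" "0 < r" "r \<le> T"
  shows "\<exists>d>0. \<forall>a. r - d < a \<and> a < r \<longrightarrow> graph_piece c a r"
proof -
  obtain e1 where e1: "e1 > 0" "\<And>h. 0 \<le> h \<Longrightarrow> h \<le> e1 \<Longrightarrow> c (r - h) = \<Gamma> (m r - h)"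
    using cornered_loopD(4)[OF assms] by auto
  obtain \<sigma> e2 where e2: "\<sigma> = 1 \<or> \<sigma> = -1" "e2 > 0" "\<And>h. 0 < h \<Longrightarrow> h < e2 \<Longrightarrow> \<sigma> * Re (V (m r - h)) > 0"
    using Re_V_sign(2)[of "m r"] by metis
  have "graph_piece c a r" if a: "a < r" "r - min e1 e2 < a" for a
  proof -
    have "c x = \<Gamma> (m r - r + x)" if "x \<in> {a..r}" for x
      using e1(2)[of "r - x"] that a by (auto simp: algebra_simps)
    moreover have "\<sigma> * Re (V (m r - r + x)) > 0" if "x \<in> {a<..<r}" for x
      using e2(3)[of "r - x"] that a by (auto simp: algebra_simps)
    ultimately show ?thesis
      unfolding graph_piece_def using a(1) e2(1) by blast
  qed
  then show ?thesis using e1(1) e2(2) by (intro exI[of _ "min e1 e2"]) auto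
qed

definition graph_partition :: "(real \<Rightarrow> complex) \<Rightarrow> real \<Rightarrow> real \<Rightarrow> nat \<Rightarrow> (nat \<Rightarrow> real) \<Rightarrow> bool" where
  "graph_partition c a b n r \<longleftrightarrow> r 0 = a \<and> r n = b \<and> (\<forall>i<n. graph_piece c (r i) (r (Suc i)))"

lemma graph_partition_append:
  assumes "graph_partition c a b n r" "graph_partition c b d n' r'"
  shows "graph_partition c a d (n + n') (\<lambda>i. if i \<le> n then r i else r' (i - n))"
  unfolding graph_partition_def
proof (intro conjI allI impI)
  fix i assume i: "i < n + n'"
  show "graph_piece c (if i \<le> n then r i else r' (i - n)) (if Suc i \<le> n then r (Suc i) else r' (Suc i - n))"
  proof (cases "i < n")
    case True
    then show ?thesis using assms(1) by (simp add: graph_partition_def)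
  next
    case False
    then have "graph_piece c (r' (i - n)) (r' (Suc (i - n)))"
      using assms(2) i by (simp add: graph_partition_def)
    then show ?thesis using False assms by (auto simp: graph_partition_def Suc_diff_le not_less)
  qed
qed (use assms in \<open>auto simp: graph_partition_def\<close>)

lemma ex_graph_partition:
  assumes c: "cornered_loop T c p m"
  shows "\<exists>n r. graph_partition c 0 T n r"
proof -
  have triv: "\<exists>n r. graph_partition c a a n r" for a
    by (intro exI[of _ 0] exI[of _ "\<lambda>_. a"]) (simp add: graph_partition_def)
  have one: "\<exists>n r. graph_partition c a b n r" if "graph_piece c a b" for a b
    using that by (intro exI[of _ "Suc 0"] exI[of _ "\<lambda>i. if i = 0 then a else b"]) (simp add: graph_partition_def)
  \<comment> \<open>Bisection asks about all short intervals around a time, also those that leave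
    \<open>[0, T]\<close>; hence the two guards.\<close>
  define P where "P a b \<longleftrightarrow> (0 \<le> a \<longrightarrow> b \<le> T \<longrightarrow> (\<exists>n r. graph_partition c a b n r))" for a b
  have "P 0 T"
  proof (rule Bolzano[where P = P])
    show "0 \<le> T" using cornered_loopD(1)[OF c] by simp
    show "P x z" if "P x y" "P y z" "x \<le> y" "y \<le> z" for x y z
      using that graph_partition_append unfolding P_def by (meson order_trans)
  next
    fix x assume local: "0 \<le> x" "x \<le> T"
    obtain d1 where d1: "d1 > 0" "\<And>b. x < b \<Longrightarrow> b < x + d1 \<Longrightarrow> b \<le> T \<Longrightarrow> graph_piece c x b"
      using graph_piece_right[OF c, of x] local by (cases "x < T") (auto intro: that[of 1])
    obtain d2 where d2: "d2 > 0" "\<And>a. x - d2 < a \<Longrightarrow> a < x \<Longrightarrow> 0 \<le> a \<Longrightarrow> graph_piece c a x"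
      using graph_piece_left[OF c, of x] local by (cases "0 < x") (auto intro: that[of 1])
    have "\<exists>n r. graph_partition c a b n r" if ab: "a \<le> x" "x \<le> b" "b - a < min d1 d2" "0 \<le> a" "b \<le> T" for a b
    proof -
      have "\<exists>n r. graph_partition c a x n r"
        using one[OF d2(2)[of a]] triv[of x] ab by (cases "a = x") auto
      moreover have "\<exists>n r. graph_partition c x b n r"
        using one[OF d1(2)[of b]] triv[of x] ab by (cases "b = x") auto
      ultimately show ?thesis using graph_partition_append by blast
    qed
    then show "\<exists>d>0. \<forall>a b. a \<le> x \<and> x \<le> b \<and> b - a < d \<longrightarrow> P a b"
      using d1(1) d2(1) unfolding P_def by (intro exI[of _ "min d1 d2"]) auto
  qed
  then show ?thesis unfolding P_def by simp
qed


section \<open>Graph pieces as functions of the horizontal coordinate\<close>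

lemma continuous_on_graph_piece:
  assumes "graph_piece c a b"
  shows "continuous_on {a..b} c"
proof -
  obtain u where u: "\<And>r. r \<in> {a..b} \<Longrightarrow> c r = \<Gamma> (u + r)"
    using assms unfolding graph_piece_def by blast
  have "continuous_on {a..b} (\<lambda>r. \<Gamma> (u + r))"
    by (intro continuous_on_compose2[OF cont_\<Gamma>[of UNIV]] continuous_intros) auto
  then show ?thesis by (rule continuous_on_eq) (use u in auto)
qed

lemma graph_piece_monotone:
  assumes gp: "graph_piece c a b"
  obtains \<sigma> :: real where "\<sigma> = 1 \<or> \<sigma> = -1"
    "\<And>x y. a \<le> x \<Longrightarrow> x < y \<Longrightarrow> y \<le> b \<Longrightarrow> \<sigma> * Re (c x) < \<sigma> * Re (c y)"
proof -
  obtain u \<sigma> where u: "a < b" "\<sigma> = 1 \<or> \<sigma> = -1" "\<And>r. r \<in> {a..b} \<Longrightarrow> c r = \<Gamma> (u + r)"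
    "\<And>r. r \<in> {a<..<b} \<Longrightarrow> \<sigma> * Re (V (u + r)) > 0"
    using gp unfolding graph_piece_def by blast
  define f where "f r = \<sigma> * Re (\<Gamma> (u + r))" for r
  have df: "(f has_real_derivative \<sigma> * Re (V (u + r))) (at r)" for r
    using deriv_coord(1)[of "u + r"] unfolding f_def
    by (intro DERIV_cmult) (simp add: DERIV_shift add.commute[of u])
  have contf: "continuous_on S f" for S
    using df by (meson DERIV_isCont continuous_at_imp_continuous_on)
  have "f x < f y" if "a \<le> x" "x < y" "y \<le> b" for x y
  proof (rule DERIV_pos_imp_increasing_open[OF \<open>x < y\<close> _ contf])
    show "\<exists>D. (f has_real_derivative D) (at z) \<and> D > 0" if "x < z" "z < y" for z
      using df[of z] u(4)[of z] that \<open>a \<le> x\<close> \<open>y \<le> b\<close> by (intro exI conjI) auto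
  qed
  then show thesis using u(3) by (intro that[OF u(2)]) (simp add: f_def)
qed

lemma graph_piece_increasing:
  assumes gp: "graph_piece c a b" and st: "a \<le> s" "s < t" "t \<le> b" "Re (c s) < Re (c t)"
    and xy: "a \<le> x" "x < y" "y \<le> b"
  shows "Re (c x) < Re (c y)"
  using graph_piece_monotone[OF gp] st xy
  by (metis mult_1 mult_minus1 neg_less_iff_less less_asym)

lemma graph_piece_x_coordinate:
  assumes gp: "graph_piece c a b"
  shows "inj_on (\<lambda>r. Re (c r)) {a..b}" (is ?inj)
    and "(\<lambda>r. Re (c r)) ` {a..b} = x_range c a b" (is ?im)
proof -
  have "a < b" using gp by (simp add: graph_piece_def)
  obtain \<sigma> :: real where \<sigma>: "\<sigma> = 1 \<or> \<sigma> = -1"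
    and mono: "\<And>x y. a \<le> x \<Longrightarrow> x < y \<Longrightarrow> y \<le> b \<Longrightarrow> \<sigma> * Re (c x) < \<sigma> * Re (c y)"
    using graph_piece_monotone[OF gp] by blast
  show ?inj
  proof (rule inj_onI)
    fix x y assume xy: "x \<in> {a..b}" "y \<in> {a..b}" "Re (c x) = Re (c y)"
    then show "x = y" using mono[of x y] mono[of y x] by (cases x y rule: linorder_cases) auto
  qed
  have "(\<lambda>r. Re (c r)) ` {a..b} = (*) \<sigma> ` ((\<lambda>r. \<sigma> * Re (c r)) ` {a..b})"
    using \<sigma> by (auto simp: image_image)
  also have "(\<lambda>r. \<sigma> * Re (c r)) ` {a..b} = {\<sigma> * Re (c a)..\<sigma> * Re (c b)}"
    using \<open>a < b\<close> mono
    by (intro strict_mono_image_atLeastAtMost continuous_intros continuous_on_graph_piece[OF gp]) auto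
  also have "(*) \<sigma> ` {\<sigma> * Re (c a)..\<sigma> * Re (c b)} = x_range c a b"
    using mono[of a b] \<open>a < b\<close> \<sigma> unfolding x_range_def
    by (elim disjE) (simp_all add: image_mult_atLeastAtMost_if min_def max_def)
  finally show ?im .
qed

lemma ht_Re:
  assumes "graph_piece c a b" "r \<in> {a..b}"
  shows "ht c a b (Re (c r)) = Im (c r)"
  unfolding ht_def using the_inv_into_f_f[OF graph_piece_x_coordinate(1)[OF assms(1)] assms(2)]
  by simp

lemma ex_point_over:
  assumes "graph_piece c a b" "x \<in> x_range c a b"
  shows "\<exists>r\<in>{a..b}. c r = Complex x (ht c a b x)"
proof -
  obtain r where "r \<in> {a..b}" "x = Re (c r)"
    using assms graph_piece_x_coordinate(2)[OF assms(1)] by blast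
  then show ?thesis using ht_Re[OF assms(1)] by (metis complex_surj)
qed

lemma continuous_on_inv_x:
  assumes gp: "graph_piece c a b"
  shows "continuous_on (x_range c a b) (the_inv_into {a..b} (\<lambda>r. Re (c r)))"
  unfolding graph_piece_x_coordinate(2)[OF gp, symmetric]
  using graph_piece_x_coordinate[OF gp] continuous_on_graph_piece[OF gp]
  by (intro continuous_on_inv_into continuous_intros) auto

lemma continuous_on_ht:
  assumes gp: "graph_piece c a b"
  shows "continuous_on (x_range c a b) (ht c a b)"
  unfolding ht_def
  using graph_piece_x_coordinate[OF gp] continuous_on_graph_piece[OF gp]
  by (intro continuous_intros continuous_on_compose2[OF _ continuous_on_inv_x[OF gp]])
     (auto intro: the_inv_into_into)

lemma wt_nonzero: "wt c a b x \<noteq> 0 \<Longrightarrow> x \<in> x_range c a b"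
  by (auto simp: wt_def x_range_def of_bool_def split: if_splits)

text \<open>Substitution \<open>x = Re c\<close>: in time, \<open>Im V\<close> has derivative
  \<open>H * Re V\<close> and \<open>x\<close> has derivative \<open>Re V\<close>, so
  \<open>Im V\<close> as a function of \<open>x\<close> is a primitive of \<open>H\<close> along the
  graph. The sign in \<open>wt\<close> accounts for pieces run from right to left.\<close>

lemma graph_piece_integral:
  assumes gp: "graph_piece c a b" and AB: "x_range c a b \<subseteq> {A..B}"
    and u: "\<And>r. r \<in> {a..b} \<Longrightarrow> c r = \<Gamma> (u + r)"
    and nz: "\<And>r. r \<in> {a<..<b} \<Longrightarrow> Re (V (u + r)) \<noteq> 0"
  shows "((\<lambda>x. wt c a b x * H (Complex x (ht c a b x))) has_integral
     (Im (V (u + b)) - Im (V (u + a)))) {A..B}"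
proof -
  let ?\<rho> = "the_inv_into {a..b} (\<lambda>r. Re (c r))"
  note inj = graph_piece_x_coordinate(1)[OF gp] and im = graph_piece_x_coordinate(2)[OF gp]
  have "a < b" using gp by (simp add: graph_piece_def)
  define lo where "lo = min (Re (c a)) (Re (c b))"
  define hi where "hi = max (Re (c a)) (Re (c b))"
  have xr: "x_range c a b = {lo..hi}" by (simp add: x_range_def lo_def hi_def)
  have \<rho>_end: "?\<rho> (Re (c a)) = a" "?\<rho> (Re (c b)) = b"
    using inj \<open>a < b\<close> by (auto intro: the_inv_into_f_f)
  have \<rho>: "?\<rho> x \<in> {a..b}" "Re (c (?\<rho> x)) = x" if "x \<in> {lo..hi}" for x
    using that the_inv_into_into[OF inj, of x "{a..b}"] f_the_inv_into_f[OF inj, of x]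
    unfolding im xr by auto
  have "Re (c a) \<noteq> Re (c b)" using inj \<open>a < b\<close> by (auto dest: inj_onD)
  then have "lo < hi" by (auto simp: lo_def hi_def)
  define W where "W x = Im (V (u + ?\<rho> x))" for x
  have FTC: "((\<lambda>x. H (Complex x (ht c a b x))) has_integral (W hi - W lo)) {lo..hi}"
  \<comment> \<open>The time over \<open>x\<close> need not be differentiable at the ends, where the
    tangent may be vertical.\<close>
  proof (rule fundamental_theorem_of_calculus_interior)
    show "continuous_on {lo..hi} W" unfolding W_def
      using continuous_on_inv_x[OF gp] unfolding xr
      by (intro continuous_intros continuous_on_compose2[OF cont_V[of UNIV]]) auto
    fix x assume x: "x \<in> {lo<..<hi}"
    have xl: "x \<in> {lo..hi}" using x by auto
    have "?\<rho> x \<noteq> a" "?\<rho> x \<noteq> b" using \<rho>(2)[OF xl] x by (auto simp: lo_def hi_def)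
    then have in_ab: "?\<rho> x \<in> {a<..<b}" using \<rho>(1)[OF xl] by auto
    have d\<rho>: "(?\<rho> has_real_derivative inverse (Re (V (u + ?\<rho> x)))) (at x)"
    proof (rule DERIV_inverse_function[where f = "\<lambda>r. Re (\<Gamma> (u + r))" and a = lo and b = hi])
      show "((\<lambda>r. Re (\<Gamma> (u + r))) has_real_derivative Re (V (u + ?\<rho> x))) (at (?\<rho> x))"
        using deriv_coord(1)[of "u + ?\<rho> x"] by (simp add: DERIV_shift add.commute[of u])
      show "Re (\<Gamma> (u + ?\<rho> y)) = y" if "lo < y" "y < hi" for y
        using \<rho>[of y] u[of "?\<rho> y"] that by auto
      show "isCont ?\<rho> x"
        using continuous_on_inv_x[OF gp] x unfolding xr
        by (metis continuous_on_interior interior_atLeastAtMost_real)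
    qed (use nz in_ab x in auto)
    have "(W has_real_derivative H (\<Gamma> (u + ?\<rho> x)) * Re (V (u + ?\<rho> x)) * inverse (Re (V (u + ?\<rho> x)))) (at x)"
      unfolding W_def
      by (rule DERIV_chain2[where f = "\<lambda>s. Im (V s)" and g = "\<lambda>x. u + ?\<rho> x", OF deriv_coord(4)])
         (rule DERIV_cong, (rule derivative_intros d\<rho>)+, simp)
    moreover have "\<Gamma> (u + ?\<rho> x) = Complex x (ht c a b x)"
      using \<rho>[OF xl] u[of "?\<rho> x"] by (simp add: ht_def complex_eq_iff)
    ultimately show "(W has_vector_derivative H (Complex x (ht c a b x))) (at x)"
      using nz[OF in_ab] by (simp add: has_real_derivative_iff_has_vector_derivative mult.assoc)
  qed (use \<open>lo < hi\<close> in simp)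
  define \<sigma> :: real where "\<sigma> = (if Re (c a) < Re (c b) then 1 else -1)"
  have "((\<lambda>x. \<sigma> * H (Complex x (ht c a b x))) has_integral \<sigma> * (W hi - W lo)) {lo..hi}"
    by (rule has_integral_mult_right[OF FTC])
  moreover have "\<sigma> * (W hi - W lo) = Im (V (u + b)) - Im (V (u + a))"
    using \<rho>_end by (auto simp: \<sigma>_def W_def lo_def hi_def min_def max_def)
  \<comment> \<open>At \<open>hi\<close> the half-open weight is 0; a single point does not change
    the integral.\<close>
  moreover have "wt c a b x * y = \<sigma> * y" if "x \<in> {lo..hi} - {hi}" for x y
    using that by (auto simp: wt_def \<sigma>_def lo_def hi_def min_def max_def split: if_splits)
  ultimately have "((\<lambda>x. wt c a b x * H (Complex x (ht c a b x))) has_integral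
      (Im (V (u + b)) - Im (V (u + a)))) {lo..hi}"
    using has_integral_spike_finite[of "{hi}" "{lo..hi}"
        "\<lambda>x. wt c a b x * H (Complex x (ht c a b x))" "\<lambda>x. \<sigma> * H (Complex x (ht c a b x))"] by simp
  then show ?thesis
  proof (rule has_integral_on_superset)
    show "wt c a b x * H (Complex x (ht c a b x)) = 0" if "x \<notin> {lo..hi}" for x
      using that wt_nonzero[of c a b x] xr by auto
  qed (use AB xr in simp)
qed

text \<open>The shifted times \<open>u + a\<close>, \<open>u + b\<close> and the times
  \<open>p a\<close>, \<open>m b\<close> describe the same one-sided germs, so they have the same
  tangents. In this form the increments of adjacent pieces can be compared at the corners.\<close>

lemma graph_piece_tangent_integral:
  assumes c: "cornered_loop T c p m" and "0 \<le> a" "b \<le> T"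
    and gp: "graph_piece c a b" and AB: "x_range c a b \<subseteq> {A..B}"
  shows "((\<lambda>x. wt c a b x * H (Complex x (ht c a b x))) has_integral
     (Im (V (m b)) - Im (V (p a)))) {A..B}"
proof -
  obtain u \<sigma> where u: "a < b" "\<sigma> = 1 \<or> \<sigma> = -1" "\<And>r. r \<in> {a..b} \<Longrightarrow> c r = \<Gamma> (u + r)"
    "\<And>r. r \<in> {a<..<b} \<Longrightarrow> \<sigma> * Re (V (u + r)) > 0"
    using gp unfolding graph_piece_def by blast
  obtain e1 where e1: "e1 > 0" "\<And>h. 0 \<le> h \<Longrightarrow> h \<le> e1 \<Longrightarrow> c (a + h) = \<Gamma> (p a + h)"
    using cornered_loopD(3)[OF c, of a] u(1) assms by auto
  have "V (p a) = V (u + a)"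
  proof (rule V_eq_of_right_germ[of "min e1 (b - a)"])
    fix h assume "0 \<le> h" "h \<le> min e1 (b - a)"
    then show "\<Gamma> (p a + h) = \<Gamma> (u + a + h)"
      using e1(2)[of h] u(3)[of "a + h"] by (simp add: algebra_simps)
  qed (use e1 u in auto)
  moreover
  obtain e2 where e2: "e2 > 0" "\<And>h. 0 \<le> h \<Longrightarrow> h \<le> e2 \<Longrightarrow> c (b - h) = \<Gamma> (m b - h)"
    using cornered_loopD(4)[OF c, of b] u(1) assms by auto
  have "V (m b) = V (u + b)"
  proof (rule V_eq_of_left_germ[of "min e2 (b - a)"])
    fix h assume "0 \<le> h" "h \<le> min e2 (b - a)"
    then show "\<Gamma> (m b - h) = \<Gamma> (u + b - h)"
      using e2(2)[of h] u(3)[of "b - h"] by (simp add: algebra_simps)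
  qed (use e2 u in auto)
  ultimately show ?thesis
    using graph_piece_integral[OF gp AB u(3)] u(4) by force
qed

end

section \<open>Simple loops\<close>

text \<open>Abel summation, by removing the top level of \<open>h\<close>.\<close>

lemma sum_weighted_mono_le:
  fixes w h :: "'i \<Rightarrow> real" and \<phi> :: "real \<Rightarrow> real"
  assumes "finite J" "\<And>y. 0 \<le> (\<Sum>j\<in>J. w j * of_bool (h j < y))"
    and mono: "\<And>y y'. y \<le> y' \<Longrightarrow> \<phi> y \<le> \<phi> y'" and "\<And>j. j \<in> J \<Longrightarrow> h j \<le> M"
  shows "(\<Sum>j\<in>J. w j * \<phi> (h j)) \<le> (\<Sum>j\<in>J. w j) * \<phi> M"
  using assms(1,2,4)
proof (induction J arbitrary: M rule: finite_psubset_induct)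
  case (psubset J)
  show ?case
  proof (cases "J = {}")
    case False
    define M0 where "M0 = Max (h ` J)"
    have M0: "M0 \<in> h ` J" "\<And>j. j \<in> J \<Longrightarrow> h j \<le> M0"
      using psubset.hyps False by (auto simp: M0_def)
    define J' where "J' = {j\<in>J. h j < M0}"
    have J'J: "J' \<subset> J" using M0(1) by (auto simp: J'_def)
    have split: "sum f J = sum f J' + sum f (J - J')" for f :: "'i \<Rightarrow> real"
      using psubset.hyps J'J by (metis add.commute psubset_imp_subset sum.subset_diff)
    have top: "h j = M0" if "j \<in> J - J'" for j using that M0(2) by (force simp: J'_def)
    have "0 \<le> (\<Sum>j\<in>J'. w j * of_bool (h j < y))" for y
    proof -
      have "(\<Sum>j\<in>J. w j * of_bool (h j < min y M0)) = (\<Sum>j\<in>J'. w j * of_bool (h j < y))"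
        unfolding split using top by (auto simp: J'_def intro!: sum.cong)
      then show ?thesis using psubset.prems(1) by metis
    qed
    from psubset.IH[OF J'J this, of M0]
    have "(\<Sum>j\<in>J'. w j * \<phi> (h j)) \<le> (\<Sum>j\<in>J'. w j) * \<phi> M0"
      by (auto simp: J'_def)
    moreover have "(\<Sum>j\<in>J - J'. w j * \<phi> (h j)) = (\<Sum>j\<in>J - J'. w j) * \<phi> M0"
      using top unfolding sum_distrib_right by (intro sum.cong) auto
    ultimately have "(\<Sum>j\<in>J. w j * \<phi> (h j)) \<le> (\<Sum>j\<in>J. w j) * \<phi> M0"
      unfolding split by (simp add: distrib_right)
    also have "\<dots> \<le> (\<Sum>j\<in>J. w j) * \<phi> M"
    proof (intro mult_left_mono mono)
      show "M0 \<le> M" using M0(1) psubset.prems(2) by auto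
      have "(\<Sum>j\<in>J. w j * of_bool (h j < M0 + 1)) = (\<Sum>j\<in>J. w j)"
        using M0(2) by (intro sum.cong) (simp_all add: add_strict_increasing2 less_add_one le_less_trans[of _ M0])
      then show "0 \<le> (\<Sum>j\<in>J. w j)" using psubset.prems(1) by metis
    qed
    finally show ?thesis .
  qed simp
qed

section \<open>Signed crossings of vertical rays\<close>

text \<open>The signed crossing of the piece with the ray downwards from \<open>z\<close>. Summed
  over a closed loop it is the winding number around a point \<open>z\<close> off the loop.\<close>

definition count_below :: "(real \<Rightarrow> complex) \<Rightarrow> real \<Rightarrow> real \<Rightarrow> complex \<Rightarrow> real" where
  "count_below c a b z = wt c a b (Re z) * of_bool (ht c a b (Re z) < Im z)"

text \<open>\<open>y\<close> is meant to be the height of a fixed centre, so that only the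
  horizontal position of the moving point \<open>z\<close> can change the value.\<close>

definition end_term :: "complex \<Rightarrow> real \<Rightarrow> complex \<Rightarrow> real" where
  "end_term e y z = of_bool (Re z < Re e) * of_bool (Im e < y)"

context curvature_flow
begin

text \<open>The jumps of a single count at the end points of the piece are those of \<open>end_term\<close>, which telescope
  along a closed loop.\<close>

lemma count_below_locally:
  assumes gp: "graph_piece c a b" and z: "z \<notin> c ` {a..b}"
  shows "\<forall>\<^sub>F z' in nhds z. count_below c a b z' - count_below c a b z =
     (end_term (c b) (Im z) z' - end_term (c b) (Im z) z) - (end_term (c a) (Im z) z' - end_term (c a) (Im z) z)"
proof -
  have "a < b" using gp by (simp add: graph_piece_def)
  have lc: "\<forall>\<^sub>F z' in nhds z. (Re z' < k) = (Re z < k)" if "Re z \<noteq> k" for k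
  proof (cases "Re z < k")
    case True
    have "\<forall>\<^sub>F z' in nhds z. Re z' < k"
      by (rule order_tendstoD(2)[OF _ True]) (intro tendsto_intros filterlim_ident)
    then show ?thesis using True by (auto elim: eventually_mono)
  next
    case False
    then have "k < Re z" using that by simp
    have "\<forall>\<^sub>F z' in nhds z. k < Re z'"
      by (rule order_tendstoD(1)[OF _ \<open>k < Re z\<close>]) (intro tendsto_intros filterlim_ident)
    then show ?thesis using False by (auto elim: eventually_mono)
  qed
  show ?thesis
  proof (cases "Re z \<in> x_range c a b")
    case False
    have "closed (x_range c a b)" by (simp add: x_range_def)
    then have "open (Re -` (- x_range c a b))"
      by (intro open_vimage continuous_intros) auto
    from eventually_nhds_in_open[OF this, of z]
    have "\<forall>\<^sub>F z' in nhds z. Re z' \<notin> x_range c a b"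
      using False by simp
    moreover have "Re z \<noteq> Re (c a)" "Re z \<noteq> Re (c b)"
      using False by (auto simp: x_range_def)
    note lc[OF this(1)] lc[OF this(2)]
    ultimately show ?thesis
    proof eventually_elim
      case (elim z')
      then have "wt c a b (Re z') = 0" "wt c a b (Re z) = 0"
        using False wt_nonzero by blast+
      then show ?case using elim by (simp add: count_below_def end_term_def)
    qed
  next
    case True
    have "ht c a b (Re z) \<noteq> Im z"
      using ex_point_over[OF gp True] z by (metis complex_surj imageI)
    define \<kappa> where "\<kappa> \<longleftrightarrow> ht c a b (Re z) < Im z"
    define S where "S = {z'. Re z' \<in> x_range c a b}"
    have "continuous_on S (\<lambda>z'. ht c a b (Re z') - Im z')"
      by (intro continuous_intros continuous_on_compose2[OF continuous_on_ht[OF gp]]) (auto simp: S_def)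
    then have lim: "((\<lambda>z'. ht c a b (Re z') - Im z') \<longlongrightarrow> ht c a b (Re z) - Im z) (at z within S)"
      using True by (auto simp: continuous_on_def S_def)
    have "\<forall>\<^sub>F z' in at z within S. (ht c a b (Re z') < Im z') = \<kappa>"
    proof (cases \<kappa>)
      case True
      then have "\<forall>\<^sub>F z' in at z within S. ht c a b (Re z') - Im z' < 0"
        by (intro order_tendstoD(2)[OF lim]) (simp add: \<kappa>_def)
      then show ?thesis using True by (auto elim: eventually_mono)
    next
      case False
      then have "\<forall>\<^sub>F z' in at z within S. ht c a b (Re z') - Im z' > 0"
        using \<open>ht c a b (Re z) \<noteq> Im z\<close> by (intro order_tendstoD(1)[OF lim]) (simp add: \<kappa>_def)
      then show ?thesis using False by (auto elim: eventually_mono)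
    qed
    then have near: "\<forall>\<^sub>F z' in nhds z. Re z' \<in> x_range c a b \<longrightarrow> (ht c a b (Re z') < Im z') = \<kappa>"
      unfolding eventually_at_filter S_def by (auto elim!: eventually_mono simp: \<kappa>_def)
    \<comment> \<open>An end point on the vertical line through \<open>z\<close> has the height of
      the graph there, so it is below \<open>z\<close> exactly if \<kappa>, and both differences
      vanish. Any other end point stays on its side of the vertical line through the moving
      point.\<close>
    have ends: "\<forall>\<^sub>F z' in nhds z. of_bool (Re z' < Re e) * of_bool \<kappa> - end_term e (Im z) z' =
        (of_bool (Re z < Re e) * of_bool \<kappa> - end_term e (Im z) z :: real)" if e: "e = c a \<or> e = c b" for e
    proof (cases "Re e = Re z")
      case True
      then have "Im e = ht c a b (Re z)"
        using e ht_Re[OF gp, of a] ht_Re[OF gp, of b] \<open>a < b\<close> by auto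
      then show ?thesis by (simp add: end_term_def \<kappa>_def)
    next
      case False
      then have "\<forall>\<^sub>F z' in nhds z. (Re z' < Re e) = (Re z < Re e)" by (intro lc) auto
      then show ?thesis by eventually_elim (simp add: end_term_def)
    qed
    from near ends[OF disjI1[OF refl]] ends[OF disjI2[OF refl]] show ?thesis
    proof eventually_elim
      case (elim z')
      have "count_below c a b z' = wt c a b (Re z') * of_bool \<kappa>"
        using elim(1) wt_nonzero[of c a b "Re z'"] by (cases "wt c a b (Re z') = 0") (auto simp: count_below_def)
      moreover have "count_below c a b z = wt c a b (Re z) * of_bool \<kappa>"
        by (simp add: count_below_def \<kappa>_def)
      ultimately show ?case
        using elim(2,3) by (simp add: wt_def left_diff_distrib)
    qed
  qed
qed

lemma graph_partition_mono:
  assumes "graph_partition c a b n r" "i \<le> j" "j \<le> n"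
  shows "r i \<le> r j"
  using assms(2,3)
proof (induction j rule: dec_induct)
  case (step j)
  then have "graph_piece c (r j) (r (Suc j))" using assms(1) by (simp add: graph_partition_def)
  then have "r j < r (Suc j)" by (simp add: graph_piece_def)
  then show ?case using step by simp
qed simp

lemma graph_partition_piece:
  assumes "graph_partition c a b n r" "i < n"
  shows "graph_piece c (r i) (r (Suc i))" "a \<le> r i" "r i < r (Suc i)" "r (Suc i) \<le> b"
proof -
  show 1: "graph_piece c (r i) (r (Suc i))" using assms by (simp add: graph_partition_def)
  show "r i < r (Suc i)" using 1 by (simp add: graph_piece_def)
  have "r 0 = a" "r n = b" using assms by (auto simp: graph_partition_def)
  then show "a \<le> r i" "r (Suc i) \<le> b"
    using graph_partition_mono[OF assms(1), of 0 i] graph_partition_mono[OF assms(1), of "Suc i" n] assms(2)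
    by auto
qed

lemma graph_partition_cover:
  assumes "graph_partition c a b n r" "a < b" "x \<in> {a..<b}"
  shows "\<exists>i<n. r i \<le> x \<and> x < r (Suc i)"
proof -
  have r: "r 0 = a" "r n = b" using assms by (auto simp: graph_partition_def)
  define k where "k = (LEAST i. x < r i)"
  have k: "x < r k" "k \<le> n"
    unfolding k_def using assms(3) r by (auto intro: LeastI[of "\<lambda>i. x < r i" n] Least_le)
  then have "k \<noteq> 0" using r assms(3) by (intro notI) auto
  then have "\<not> x < r (k - 1)" unfolding k_def by (intro not_less_Least) simp
  then show ?thesis using k \<open>k \<noteq> 0\<close> by (intro exI[of _ "k - 1"]) auto
qed

lemma graph_partition_cover_closed:
  assumes "graph_partition c a b n r" "a < b" "x \<in> {a..b}"
  shows "\<exists>i<n. x \<in> {r i..r (Suc i)}"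
proof (cases "x = b")
  case True
  have r: "r 0 = a" "r n = b" using assms by (auto simp: graph_partition_def)
  then have "n \<noteq> 0" using assms(2) by (intro notI) auto
  then obtain k where "n = Suc k" by (cases n) auto
  then show ?thesis using True r graph_partition_piece(3)[OF assms(1), of k] by (intro exI[of _ k]) auto
next
  case False
  then show ?thesis using graph_partition_cover[OF assms(1,2), of x] assms(3) by force
qed

lemma continuous_on_cornered_loop:
  assumes "cornered_loop T c p m"
  shows "continuous_on {0..T} c"
proof -
  obtain n r where r: "graph_partition c 0 T n r" using ex_graph_partition[OF assms] by blast
  have "continuous_on {0..r i} c" if "i \<le> n" for i
    using that
  proof (induction i)
    case 0
    then show ?case using r by (simp add: graph_partition_def)
  next
    case (Suc i)
    have "{0..r (Suc i)} = {0..r i} \<union> {r i..r (Suc i)}"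
      using graph_partition_piece[OF r, of i] Suc.prems by auto
    moreover have "continuous_on {r i..r (Suc i)} c"
      using continuous_on_graph_piece graph_partition_piece(1)[OF r, of i] Suc.prems by auto
    ultimately show ?case using Suc by (simp add: continuous_on_closed_Un)
  qed
  from this[of n] show ?thesis using r by (simp add: graph_partition_def)
qed

lemma sum_count_below_locally_constant:
  assumes c: "cornered_loop T c p m" and r: "graph_partition c 0 T n r" and z: "z \<notin> c ` {0..T}"
  shows "\<forall>\<^sub>F z' in nhds z. (\<Sum>i<n. count_below c (r i) (r (Suc i)) z') = (\<Sum>i<n. count_below c (r i) (r (Suc i)) z)"
proof -
  define E where "E i z' = end_term (c (r i)) (Im z) z' - end_term (c (r i)) (Im z) z" for i z'
  have "\<forall>\<^sub>F z' in nhds z. \<forall>i\<in>{..<n}. count_below c (r i) (r (Suc i)) z' - count_below c (r i) (r (Suc i)) z = E (Suc i) z' - E i z'"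
  proof (intro eventually_ball_finite ballI finite_lessThan)
    fix i assume i: "i \<in> {..<n}"
    then have "z \<notin> c ` {r i..r (Suc i)}"
      using graph_partition_piece[OF r, of i] z by force
    then show "\<forall>\<^sub>F z' in nhds z. count_below c (r i) (r (Suc i)) z' - count_below c (r i) (r (Suc i)) z = E (Suc i) z' - E i z'"
      using count_below_locally graph_partition_piece(1)[OF r, of i] i unfolding E_def by auto
  qed
  then show ?thesis
  proof eventually_elim
    case (elim z')
    have "(\<Sum>i<n. count_below c (r i) (r (Suc i)) z') - (\<Sum>i<n. count_below c (r i) (r (Suc i)) z)
        = (\<Sum>i<n. E (Suc i) z' - E i z')"
      unfolding sum_subtractf[symmetric] using elim by (intro sum.cong) auto
    also have "\<dots> = E n z' - E 0 z'" by (rule sum_lessThan_telescope)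
    also have "\<dots> = 0" using r cornered_loopD(2)[OF c] by (simp add: E_def graph_partition_def)
    finally show ?case by simp
  qed
qed

section \<open>Simple loops and the Jordan curve theorem\<close>

lemma simple_path_cornered_loop:
  assumes c: "cornered_loop T c p m" and simple: "double_points T c = {(0, T)}"
  shows "simple_path (\<lambda>x. c (x * T))" "path_image (\<lambda>x. c (x * T)) = c ` {0..T}"
    "pathfinish (\<lambda>x. c (x * T)) = pathstart (\<lambda>x. c (x * T))"
proof -
  have T: "T > 0" using cornered_loopD(1)[OF c] .
  have "path (\<lambda>x. c (x * T))" unfolding path_def
    by (intro continuous_on_compose2[OF continuous_on_cornered_loop[OF c]] continuous_intros)
       (use T in \<open>auto intro: mult_left_le_one_le\<close>)
  moreover have "loop_free (\<lambda>x. c (x * T))" unfolding loop_free_def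
  proof (intro ballI impI)
    fix x y :: real assume xy: "x \<in> {0..1}" "y \<in> {0..1}" and eq: "c (x * T) = c (y * T)"
    have *: "(x * T, y * T) = (0, T)" if "x < y" "x \<in> {0..1}" "y \<in> {0..1}" "c (x * T) = c (y * T)" for x y
    proof -
      have "(x * T, y * T) \<in> double_points T c"
        using that T by (simp add: double_points_def mult_left_le_one_le)
      then show ?thesis using simple by simp
    qed
    show "x = y \<or> x = 0 \<and> y = 1 \<or> x = 1 \<and> y = 0"
      using *[of x y] *[of y x] xy eq T by (cases x y rule: linorder_cases) auto
  qed
  ultimately show "simple_path (\<lambda>x. c (x * T))" by (simp add: simple_path_def)
  have "(\<lambda>x. x * T) ` {0..1} = {0..T}"
    using T by (simp add: image_mult_atLeastAtMost_if')
  then show "path_image (\<lambda>x. c (x * T)) = c ` {0..T}"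
    unfolding path_image_def by (metis image_image)
  show "pathfinish (\<lambda>x. c (x * T)) = pathstart (\<lambda>x. c (x * T))"
    using cornered_loopD(2)[OF c] by (simp add: pathfinish_def pathstart_def)
qed

text \<open>The complement of the loop has two components, and the count is constant on each. It is
  0 on the outside, as seen from far below, so \<open>z0\<close> lies inside and gives the value 1
  there. The orientation enters only through \<open>z0\<close>.\<close>

lemma sum_count_below_nonneg:
  assumes c: "cornered_loop T c p m" and simple: "double_points T c = {(0, T)}"
    and r: "graph_partition c 0 T n r"
  defines "N \<equiv> \<lambda>z. \<Sum>i<n. count_below c (r i) (r (Suc i)) z"
  assumes z0: "z0 \<notin> c ` {0..T}" "N z0 = 1" and z: "z \<notin> c ` {0..T}"
  shows "0 \<le> N z"
proof -
  let ?K = "c ` {0..T}"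
  have jordan: "connected (inside ?K)" "connected (outside ?K)" "inside ?K \<union> outside ?K = - ?K"
    "open (inside ?K)" "open (outside ?K)"
    using Jordan_inside_outside[OF simple_path_cornered_loop(1,3)[OF c simple]]
    unfolding simple_path_cornered_loop(2)[OF c simple] by auto
  have const: "N constant_on S" if "connected S" "S \<subseteq> - ?K" for S
  proof (rule locally_constant_imp_constant[OF that(1)])
    fix a assume "a \<in> S"
    then have "\<forall>\<^sub>F z' in nhds a. N z' = N a"
      using that(2) sum_count_below_locally_constant[OF c r] unfolding N_def by blast
    then obtain U where "open U" "a \<in> U" "\<forall>z'\<in>U. N z' = N a"
      unfolding eventually_nhds by blast
    moreover from this(1) have "openin (top_of_set S) (S \<inter> U)"
      by (rule openin_open_Int)
    ultimately show "\<exists>T. openin (top_of_set S) T \<and> a \<in> T \<and> (\<forall>x\<in>T. N x = N a)"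
      using \<open>a \<in> S\<close> by blast
  qed
  have "compact ?K" by (intro compact_continuous_image continuous_on_cornered_loop[OF c]) simp
  then obtain R where R: "\<And>z. z \<in> ?K \<Longrightarrow> norm z \<le> R"
    by (meson bounded_iff compact_imp_bounded)
  \<comment> \<open>A point below a disc that contains the loop: it is outside, and no piece passes
    under it.\<close>
  define zf where "zf = Complex 0 (- \<bar>R\<bar> - 1)"
  have "norm zf = \<bar>R\<bar> + 1" by (simp add: zf_def complex_norm)
  then have "zf \<in> - cball 0 R" by simp
  moreover have "?K \<subseteq> cball 0 R" using R unfolding subset_iff mem_cball_0 by blast
  ultimately have zf_out: "zf \<in> outside ?K"
    using outside_subset_convex[OF convex_cball] by blast
  have "count_below c (r i) (r (Suc i)) zf = 0" if i: "i < n" for i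
  proof (cases "Re zf \<in> x_range c (r i) (r (Suc i))")
    case True
    note gp = graph_partition_piece[OF r i]
    obtain x where x: "x \<in> {r i..r (Suc i)}" "c x = Complex (Re zf) (ht c (r i) (r (Suc i)) (Re zf))"
      using ex_point_over[OF gp(1) True] by blast
    have "norm (c x) \<le> R" using R[of "c x"] x(1) gp by auto
    then have "\<bar>Im (c x)\<bar> \<le> R" using abs_Im_le_cmod order_trans by blast
    then have "\<not> ht c (r i) (r (Suc i)) (Re zf) < Im zf" using x(2) by (simp add: zf_def)
    then show ?thesis by (simp add: count_below_def)
  next
    case False
    then show ?thesis using wt_nonzero unfolding count_below_def by fastforce
  qed
  then have "N zf = 0" by (simp add: N_def)
  moreover have "N constant_on outside ?K" using const jordan by blast
  ultimately have out: "N w = 0" if "w \<in> outside ?K" for w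
    using zf_out that unfolding constant_on_def by metis
  have "z0 \<in> inside ?K" using out[of z0] z0 jordan(3) by (metis ComplI UnE zero_neq_one)
  moreover have "N constant_on inside ?K" using const jordan by blast
  ultimately have "N w = 1" if "w \<in> inside ?K" for w
    using z0(2) that unfolding constant_on_def by metis
  moreover have "z \<in> inside ?K \<or> z \<in> outside ?K" using z jordan(3) by blast
  ultimately show ?thesis using out[of z] by fastforce
qed

text \<open>At time \<open>0\<close> the loop arrives with the tangent at \<open>m T\<close>, whence \<open>t'\<close>.\<close>

lemma lowest_point_tangents:
  assumes c: "cornered_loop T c p m"
  obtains t t' where "0 \<le> t" "t < T" "t' = (if t = 0 then T else t)"
    "\<And>r. r \<in> {0..T} \<Longrightarrow> Im (c t) \<le> Im (c r)" "V (p t) = 1" "V (m t') = 1"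
proof -
  have T: "T > 0" using cornered_loopD(1)[OF c] .
  have "continuous_on {0..T} (\<lambda>r. Im (c r))"
    by (intro continuous_intros continuous_on_cornered_loop[OF c])
  then obtain t0 where t0: "t0 \<in> {0..T}" "\<And>r. r \<in> {0..T} \<Longrightarrow> Im (c t0) \<le> Im (c r)"
    using continuous_attains_inf[of "{0..T}" "\<lambda>r. Im (c r)"] T by auto
  define t where "t = (if t0 = T then 0 else t0)"
  define t' where "t' = (if t = 0 then T else t)"
  have t: "0 \<le> t" "t < T" using t0 T by (auto simp: t_def)
  have t': "0 < t'" "t' \<le> T" using t T by (auto simp: t'_def)
  have ct': "c t' = c t" using cornered_loopD(2)[OF c] by (auto simp: t'_def)
  have low: "Im (c t) \<le> Im (c r)" if "r \<in> {0..T}" for r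
    using t0(2)[OF that] cornered_loopD(2)[OF c] by (auto simp: t_def)
  obtain e1 where e1: "e1 > 0" "\<And>h. 0 \<le> h \<Longrightarrow> h \<le> e1 \<Longrightarrow> c (t + h) = \<Gamma> (p t + h)"
    using cornered_loopD(3)[OF c t] by auto
  obtain e2 where e2: "e2 > 0" "\<And>h. 0 \<le> h \<Longrightarrow> h \<le> e2 \<Longrightarrow> c (t' - h) = \<Gamma> (m t' - h)"
    using cornered_loopD(4)[OF c t'] by auto
  define d where "d = min (min e1 e2) (min (T - t) t')"
  have d: "d > 0" using e1(1) e2(1) t t' by (simp add: d_def)
  have up: "Im (\<Gamma> (p t)) \<le> Im (\<Gamma> (p t + h))" if "0 \<le> h" "h \<le> d" for h
    using low[of "t + h"] e1(2)[of 0] e1(2)[of h] e1(1) that t by (simp add: d_def)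
  have up': "Im (\<Gamma> (m t')) \<le> Im (\<Gamma> (m t' - h))" if "0 \<le> h" "h \<le> d" for h
    using low[of "t' - h"] e2(2)[of 0] e2(2)[of h] e2(1) that t' ct' by (simp add: d_def)
  have "Im (V (p t)) \<ge> 0"
  proof (rule ccontr)
    assume "\<not> ?thesis"
    then obtain d' where "d' > 0" "\<And>h. h > 0 \<Longrightarrow> h < d' \<Longrightarrow> Im (\<Gamma> (p t + h)) < Im (\<Gamma> (p t))"
      using DERIV_neg_dec_right[OF deriv_coord(2), of "p t"] by auto
    moreover obtain k where "0 < k" "k < d" "k < d'"
      using d \<open>d' > 0\<close> dense[of 0 "min d d'"] by auto
    ultimately show False using up[of k] by fastforce
  qed
  moreover have "Im (V (m t')) \<le> 0"
  proof (rule ccontr)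
    assume "\<not> ?thesis"
    then obtain d' where "d' > 0" "\<And>h. h > 0 \<Longrightarrow> h < d' \<Longrightarrow> Im (\<Gamma> (m t' - h)) < Im (\<Gamma> (m t'))"
      using DERIV_pos_inc_left[OF deriv_coord(2), of "m t'"] by auto
    moreover obtain k where "0 < k" "k < d" "k < d'"
      using d \<open>d' > 0\<close> dense[of 0 "min d d'"] by auto
    ultimately show False using up'[of k] by fastforce
  qed
  moreover have "Im (V (p t)) \<le> Im (V (m t'))"
    using cornered_loopD(5)[OF c, of t] cornered_loopD(6)[OF c] t by (auto simp: t'_def)
  ultimately have im: "Im (V (p t)) = 0" "Im (V (m t')) = 0" by linarith+
  \<comment> \<open>A horizontal tangent to the left would make the height strictly maximal. Since
    minimality is known on one side only, after \<open>p t\<close> or before \<open>m t'\<close>,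
    the premise \<open>above\<close> asks just for some points arbitrarily close.\<close>
  have re: "Re (V s) = 1" if im: "Im (V s) = 0" and
    above: "\<And>e. e > 0 \<Longrightarrow> \<exists>s'. s' \<noteq> s \<and> \<bar>s' - s\<bar> < e \<and> Im (\<Gamma> s) \<le> Im (\<Gamma> s')" for s
  proof (rule ccontr)
    assume "Re (V s) \<noteq> 1"
    then have "Re (V s) = -1" using V_sq[of s] im by (simp add: power2_eq_1_iff)
    have "\<exists>e>0. \<forall>s'. s' \<noteq> s \<longrightarrow> \<bar>s' - s\<bar> < e \<longrightarrow> - Im (\<Gamma> s) < - Im (\<Gamma> s')"
    proof (rule strict_local_min_second_derivative)
      show "((\<lambda>s. - Im (\<Gamma> s)) has_real_derivative - Im (V s)) (at s)" for s
        by (intro DERIV_minus deriv_coord)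
      show "((\<lambda>s. - Im (V s)) has_real_derivative - (H (\<Gamma> s) * Re (V s))) (at s)"
        by (intro DERIV_minus deriv_coord)
    qed (use im \<open>Re (V s) = -1\<close> H_pos in auto)
    then show False using above by (metis neg_less_iff_less not_less)
  qed
  have "V (p t) = 1"
  proof -
    have "Re (V (p t)) = 1"
    proof (rule re[OF im(1)])
      show "\<exists>s'. s' \<noteq> p t \<and> \<bar>s' - p t\<bar> < e \<and> Im (\<Gamma> (p t)) \<le> Im (\<Gamma> s')" if "e > 0" for e
        using up[of "min d e / 2"] that d by (intro exI[of _ "p t + min d e / 2"]) (auto simp: min_def)
    qed
    then show ?thesis using im by (simp add: complex_eq_iff)
  qed
  moreover have "V (m t') = 1"
  proof -
    have "Re (V (m t')) = 1"
    proof (rule re[OF im(2)])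
      show "\<exists>s'. s' \<noteq> m t' \<and> \<bar>s' - m t'\<bar> < e \<and> Im (\<Gamma> (m t')) \<le> Im (\<Gamma> s')" if "e > 0" for e
        using up'[of "min d e / 2"] that d by (intro exI[of _ "m t' - min d e / 2"]) (auto simp: min_def)
    qed
    then show ?thesis using im by (simp add: complex_eq_iff)
  qed
  ultimately show thesis using that[OF t t'_def low] by blast
qed

text \<open>As the loop closes up, it crosses each vertical line as often to the right as to the
  left.\<close>

lemma sum_wt_eq_0:
  assumes "cornered_loop T c p m" "graph_partition c 0 T n r"
  shows "(\<Sum>i<n. wt c (r i) (r (Suc i)) x) = 0"
proof -
  have "(\<Sum>i<n. wt c (r i) (r (Suc i)) x) = of_bool (x < Re (c (r n))) - of_bool (x < Re (c (r 0)))"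
    unfolding wt_def by (rule sum_lessThan_telescope)
  then show ?thesis using assms cornered_loopD(2)[OF assms(1)] by (simp add: graph_partition_def)
qed

text \<open>A box just above the lowest point and to its right, which only the piece \<open>k\<close> passes below.\<close>

lemma lowest_arc_box:
  assumes c: "cornered_loop T c p m" and simple: "double_points T c = {(0, T)}"
    and r: "graph_partition c 0 T n r"
  obtains k x1 x2 y1 y2 where "k < n" "x1 < x2" "y1 < y2"
    "\<And>x. x \<in> {x1..x2} \<Longrightarrow> wt c (r k) (r (Suc k)) x = 1"
    "\<And>x. x \<in> {x1..x2} \<Longrightarrow> ht c (r k) (r (Suc k)) x < y1"
    "\<And>i x. i < n \<Longrightarrow> i \<noteq> k \<Longrightarrow> x \<in> {x1..x2} \<Longrightarrow> wt c (r i) (r (Suc i)) x \<noteq> 0 \<Longrightarrow> y2 < ht c (r i) (r (Suc i)) x"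
    "\<And>z. Re z \<in> {x1..x2} \<Longrightarrow> Im z \<in> {y1..y2} \<Longrightarrow> z \<notin> c ` {0..T}"
proof -
  have T: "T > 0" using cornered_loopD(1)[OF c] .
  obtain t t' where t: "0 \<le> t" "t < T" "t' = (if t = 0 then T else t)"
    and low: "\<And>x. x \<in> {0..T} \<Longrightarrow> Im (c t) \<le> Im (c x)" and V: "V (p t) = 1" "V (m t') = 1"
    using lowest_point_tangents[OF c] by metis
  have t': "0 < t'" "t' \<le> T" using t T by auto
  have ct': "c t' = c t" using cornered_loopD(2)[OF c] t by auto
  obtain k where k: "k < n" "r k \<le> t" "t < r (Suc k)"
    using graph_partition_cover[OF r T, of t] t by auto
  note gp = graph_partition_piece[OF r k(1)]
  obtain e1 where e1: "e1 > 0" "\<And>h. 0 \<le> h \<Longrightarrow> h \<le> e1 \<Longrightarrow> c (t + h) = \<Gamma> (p t + h)"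
    using cornered_loopD(3)[OF c t(1,2)] by auto
  obtain e2 where e2: "e2 > 0" "\<And>h. 0 \<le> h \<Longrightarrow> h \<le> e2 \<Longrightarrow> c (t' - h) = \<Gamma> (m t' - h)"
    using cornered_loopD(4)[OF c t'] by auto
  obtain d1 where d1: "d1 > 0" "\<And>h. h > 0 \<Longrightarrow> h < d1 \<Longrightarrow> Re (\<Gamma> (p t)) < Re (\<Gamma> (p t + h))"
    using DERIV_pos_inc_right[OF deriv_coord(1), of "p t"] V by auto
  obtain d2 where d2: "d2 > 0" "\<And>h. h > 0 \<Longrightarrow> h < d2 \<Longrightarrow> Re (\<Gamma> (m t' - h)) < Re (\<Gamma> (m t'))"
    using DERIV_pos_inc_left[OF deriv_coord(1), of "m t'"] V by auto
  define e where "e = min (min e1 e2) (min (min d1 d2) (r (Suc k) - t)) / 2"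
  have "0 < min (min e1 e2) (min (min d1 d2) (r (Suc k) - t))"
    using e1 e2 d1 d2 k by simp
  then have e: "0 < e" "e < e1" "e < e2" "e < d1" "e < d2" "e < r (Suc k) - t"
    by (auto simp: e_def min_def)
  have right: "Re (c t) < Re (c (t + h))" if "0 < h" "h \<le> e" for h
    using d1(2)[of h] e1(2)[of 0] e1(2)[of h] e that by auto
  have left: "Re (c (t' - h)) < Re (c t)" if "0 < h" "h \<le> e" for h
    using d2(2)[of h] e2(2)[of 0] e2(2)[of h] e that ct' by auto
  \<comment> \<open>Times away from \<open>t\<close>, also modulo the period: for
    \<open>t = 0\<close> the second interval removes those close to \<open>T\<close>. As the loop is
    simple, this part has a positive distance \<eta> from the lowest point.\<close>
  define Z where "Z = {0..T} - ({t - e<..<t + e} \<union> {t' - e<..<t' + e})"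
  have "compact Z" unfolding Z_def by (intro compact_diff) auto
  then have "closed (c ` Z)"
    by (intro compact_imp_closed compact_continuous_image continuous_on_subset[OF continuous_on_cornered_loop[OF c]])
       (auto simp: Z_def)
  moreover have "c t \<notin> c ` Z"
  proof
    assume "c t \<in> c ` Z"
    then obtain x where x: "x \<in> Z" "c t = c x" by auto
    have "x \<noteq> t" "x \<noteq> t'" "0 \<le> x" "x \<le> T" using x(1) e by (auto simp: Z_def)
    then have "(t, x) \<in> double_points T c \<or> (x, t) \<in> double_points T c"
      using x(2) t by (auto simp: double_points_def)
    then show False using simple \<open>x \<noteq> t'\<close> t by (auto split: if_splits)
  qed
  ultimately obtain \<eta> where \<eta>: "\<eta> > 0" "\<And>z. z \<in> c ` Z \<Longrightarrow> \<eta> \<le> dist (c t) z"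
    using separate_point_closed by metis
  \<comment> \<open>Close to the lowest point there are only the arriving and the leaving branch,
    and the arriving one lies to the left of it.\<close>
  have near: "t \<le> x \<and> x < t + e" if x: "x \<in> {0..T}" "Re (c t) < Re (c x)" "Re (c x) < Re (c t) + \<eta> / 2"
    "Im (c x) < Im (c t) + \<eta> / 2" for x
  proof -
    have "dist (c t) (c x) \<le> \<bar>Re (c t - c x)\<bar> + \<bar>Im (c t - c x)\<bar>"
      unfolding dist_norm by (rule cmod_le)
    also have "\<dots> < \<eta>" using x low[OF x(1)] by auto
    finally have "x \<notin> Z" using \<eta>(2) by (meson imageI not_less)
    then consider "t \<le> x" "x < t + e" | "t' - e < x" "x \<le> t'" | "t - e < x" "x < t" "t \<noteq> 0"
      using x(1) t by (fastforce simp: Z_def split: if_splits)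
    then show ?thesis
    proof cases
      case 2
      then show ?thesis using left[of "t' - x"] x(2) ct' by (cases "x = t'") auto
    next
      case 3
      then show ?thesis using left[of "t - x"] x(2) t by auto
    qed auto
  qed
  have te: "t + e < r (Suc k)" using e by simp
  have inc: "Re (c x) < Re (c y)" if "r k \<le> x" "x < y" "y \<le> r (Suc k)" for x y
    using graph_piece_increasing[OF gp(1) k(2) _ _ right[of e]] that te e by auto
  have "continuous_on {t..t + e} (\<lambda>x. Im (c x))"
    by (intro continuous_intros continuous_on_subset[OF continuous_on_cornered_loop[OF c]]) (use t te gp in auto)
  then obtain d where d: "d > 0" "\<And>x. x \<in> {t..t + e} \<Longrightarrow> \<bar>x - t\<bar> < d \<Longrightarrow> \<bar>Im (c x) - Im (c t)\<bar> < \<eta> / 8"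
    using \<eta>(1) e(1) unfolding continuous_on_iff dist_real_def
    by (metis atLeastAtMost_iff divide_pos_pos less_add_same_cancel1 less_imp_le order_refl zero_less_numeral)
  \<comment> \<open>Up to \<open>t1\<close> the arc stays less than \<open>\<eta> / 8\<close> above
    the lowest point. The box takes the heights from \<open>\<eta> / 8\<close> to
    \<open>\<eta> / 4\<close>, inside the range \<open>\<eta> / 2\<close> of
    \<open>near\<close>.\<close>
  define t1 where "t1 = t + min (d / 2) e"
  have t1: "t < t1" "t1 \<le> t + e" "t1 - t < d" using d(1) e(1) by (auto simp: t1_def min_def)
  define x3 where "x3 = min (Re (c t1)) (Re (c t) + \<eta> / 2)"
  have x3: "Re (c t) < x3" using inc[of t t1] k t1 te \<eta>(1) by (simp add: x3_def)
  obtain x1 where x1: "Re (c t) < x1" "x1 < x3" using dense[OF x3] by blast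
  obtain x2 where x2: "x1 < x2" "x2 < x3" using dense[OF x1(2)] by blast
  note x12 = x1(1) x2
  have end1: "Re (c t1) < Re (c (r (Suc k)))" using inc[of t1 "r (Suc k)"] t1 te k by simp
  have end0: "Re (c (r k)) \<le> Re (c t)" using inc[of "r k" t] k by (cases "r k = t") auto
  define y1 where "y1 = Im (c t) + \<eta> / 8"
  define y2 where "y2 = Im (c t) + \<eta> / 4"
  have wtk: "wt c (r k) (r (Suc k)) x = 1" if "x \<in> {x1..x2}" for x
    using that x12 end0 end1 by (auto simp: wt_def x3_def)
  have htk: "ht c (r k) (r (Suc k)) x < y1" if x: "x \<in> {x1..x2}" for x
  proof -
    obtain s where s: "s \<in> {r k..r (Suc k)}" "c s = Complex x (ht c (r k) (r (Suc k)) x)"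
      using ex_point_over[OF gp(1) wt_nonzero] wtk[OF x] by force
    have "Re (c t) < Re (c s)" "Re (c s) < Re (c t1)" using s(2) x x12 by (auto simp: x3_def)
    then have "t \<noteq> s" "s \<noteq> t1" "\<not> s < t" "\<not> t1 < s"
      using inc[of s t] inc[of t1 s] s(1) k t1 te by auto
    then have "t < s" "s < t1" by auto
    then have "\<bar>Im (c s) - Im (c t)\<bar> < \<eta> / 8" using d(2)[of s] t1 by auto
    then show ?thesis using s(2) abs_ge_self[of "Im (c s) - Im (c t)"] by (simp add: y1_def)
  qed
  \<comment> \<open>The bounds \<open>s < r (Suc k)\<close> and \<open>t < s\<close> are strict
    because neighbouring pieces share end points with the piece \<open>k\<close>.\<close>
  have lowk: "r k \<le> s \<and> s < r (Suc k) \<and> t < s" if s: "s \<in> {0..T}" "Re (c s) \<in> {x1..x2}" "Im (c s) \<le> y2" for s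
  proof -
    have "t \<le> s \<and> s < t + e"
      using s x12 \<eta>(1) by (intro near) (auto simp: x3_def y2_def)
    moreover have "s \<noteq> t" using s(2) x12 by auto
    ultimately show ?thesis using k te by auto
  qed
  show thesis
  proof (rule that[OF k(1) x12(2) _ wtk htk])
    show "y1 < y2" using \<eta>(1) by (simp add: y1_def y2_def)
  next
    fix i x assume i: "i < n" "i \<noteq> k" and x: "x \<in> {x1..x2}" and w: "wt c (r i) (r (Suc i)) x \<noteq> 0"
    note gpi = graph_partition_piece[OF r i(1)]
    show "y2 < ht c (r i) (r (Suc i)) x"
    proof (rule ccontr)
      assume below: "\<not> y2 < ht c (r i) (r (Suc i)) x"
      obtain s where s: "s \<in> {r i..r (Suc i)}" "c s = Complex x (ht c (r i) (r (Suc i)) x)"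
        using ex_point_over[OF gpi(1) wt_nonzero[OF w]] by blast
      then have sk: "r k \<le> s" "s < r (Suc k)" "t < s"
        using lowk[of s] x below gpi by auto
      show False
      proof (cases "i < k")
        case True
        then have "r (Suc i) \<le> r k" using graph_partition_mono[OF r, of "Suc i" k] k by simp
        then show False using s(1) sk k by auto
      next
        case False
        then have "r (Suc k) \<le> r i" using graph_partition_mono[OF r, of "Suc k" i] i by simp
        then show False using s(1) sk by auto
      qed
    qed
  next
    fix z assume z: "Re z \<in> {x1..x2}" "Im z \<in> {y1..y2}"
    show "z \<notin> c ` {0..T}"
    proof
      assume "z \<in> c ` {0..T}"
      then obtain s where s: "s \<in> {0..T}" "z = c s" by blast
      then have "s \<in> {r k..r (Suc k)}" using lowk[of s] z by auto
      then have "ht c (r k) (r (Suc k)) (Re z) = Im z" using ht_Re[OF gp(1)] s(2) by blast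
      then show False using htk[of "Re z"] z by auto
    qed
  qed
qed

section \<open>The two signs of the integral\<close>

lemma no_simple_cornered_loop:
  assumes c: "cornered_loop T c p m" and simple: "double_points T c = {(0, T)}"
  shows False
proof -
  have T: "T > 0" using cornered_loopD(1)[OF c] .
  obtain n r where r: "graph_partition c 0 T n r" using ex_graph_partition[OF c] by blast
  have r0n: "r 0 = 0" "r n = T" using r by (auto simp: graph_partition_def)
  define w where "w i x = wt c (r i) (r (Suc i)) x" for i x
  define h where "h i x = ht c (r i) (r (Suc i)) x" for i x
  obtain k x1 x2 y1 y2 where k: "k < n" and x12: "x1 < x2" and y12: "y1 < y2"
    and wk: "\<And>x. x \<in> {x1..x2} \<Longrightarrow> w k x = 1"
    and hk: "\<And>x. x \<in> {x1..x2} \<Longrightarrow> h k x < y1"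
    and hi: "\<And>i x. i < n \<Longrightarrow> i \<noteq> k \<Longrightarrow> x \<in> {x1..x2} \<Longrightarrow> w i x \<noteq> 0 \<Longrightarrow> y2 < h i x"
    and off: "\<And>z. Re z \<in> {x1..x2} \<Longrightarrow> Im z \<in> {y1..y2} \<Longrightarrow> z \<notin> c ` {0..T}"
    using lowest_arc_box[OF c simple r] unfolding w_def h_def by metis
  define N where "N z = (\<Sum>i<n. count_below c (r i) (r (Suc i)) z)" for z
  have N_eq: "N (Complex x y) = (\<Sum>i<n. w i x * of_bool (h i x < y))" for x y
    by (simp add: N_def count_below_def w_def h_def)
  \<comment> \<open>Below this corner of the box only the piece \<open>k\<close> has nonzero weight,
    and it runs to the right; this is the point that fixes the orientation.\<close>
  have "N (Complex x1 y1) = (\<Sum>i<n. if i = k then 1 else 0)"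
    unfolding N_eq using wk[of x1] hk[of x1] hi[of _ x1] x12 y12 by (intro sum.cong) force+
  then have "N (Complex x1 y1) = 1" using k by simp
  then have N_off: "0 \<le> N z" if "z \<notin> c ` {0..T}" for z
    using sum_count_below_nonneg[OF c simple r, of "Complex x1 y1" z] off[of "Complex x1 y1"] that x12 y12
    unfolding N_def by simp
  \<comment> \<open>\<open>N_off\<close> concerns points off the loop. Lowering \<open>y\<close> to
    halfway above the next smaller height moves the point off the loop and keeps the set of heights
    below it. Junk heights may occur in \<open>A\<close>; their weight is 0.\<close>
  have N: "0 \<le> (\<Sum>i<n. w i x * of_bool (h i x < y))" for x y
  proof (cases "\<exists>i<n. h i x < y")
    case True
    define A where "A = {h i x | i. i < n \<and> h i x < y}"
    have A: "finite A" "A \<noteq> {}" using True by (auto simp: A_def)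
    define y0 where "y0 = (Max A + y) / 2"
    have "Max A \<in> A" using A by simp
    then have "Max A < y" by (auto simp: A_def)
    then have y0: "Max A < y0" "y0 < y" by (auto simp: y0_def)
    have cmp: "h i x < y0 \<longleftrightarrow> h i x < y" "h i x \<noteq> y0" if "i < n" for i
      using that y0 Max_ge[OF A(1), of "h i x"] by (fastforce simp: A_def)+
    have "Complex x y0 \<notin> c ` {0..T}"
    proof
      assume "Complex x y0 \<in> c ` {0..T}"
      then obtain s where s: "s \<in> {0..T}" "c s = Complex x y0" by auto
      then obtain i where i: "i < n" "s \<in> {r i..r (Suc i)}"
        using graph_partition_cover_closed[OF r T] by blast
      then show False
        using ht_Re[OF graph_partition_piece(1)[OF r i(1)] i(2)] s(2) cmp(2)[OF i(1)] by (simp add: h_def)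
    qed
    from N_off[OF this] show ?thesis unfolding N_eq using cmp(1) by simp
  qed simp
  have wsum: "(\<Sum>i<n. w i x) = 0" for x
    using sum_wt_eq_0[OF c r] by (simp add: w_def)
  have abel: "(\<Sum>i<n. w i x * \<phi> (h i x)) \<le> 0" if "\<And>y y'. y \<le> y' \<Longrightarrow> \<phi> y \<le> \<phi> y'" for \<phi> :: "real \<Rightarrow> real" and x
  proof -
    \<comment> \<open>Any upper bound serves, as its value gets multiplied by the total weight
      0.\<close>
    define M where "M = Max (insert 0 ((\<lambda>i. h i x) ` {..<n}))"
    have "h j x \<le> M" if "j \<in> {..<n}" for j using that by (auto simp: M_def)
    from sum_weighted_mono_le[of "{..<n}" "\<lambda>i. w i x" "\<lambda>i. h i x" \<phi> M, OF _ N that this]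
    show ?thesis by (simp add: wsum)
  qed
  define G where "G x = (\<Sum>i<n. w i x * H (Complex x (h i x)))" for x
  have G_le: "G x \<le> 0" for x
    unfolding G_def by (rule abel) (rule H_mono)
  have G_box: "G x \<le> H (Complex x y1) - H (Complex x y2)" if x: "x \<in> {x1..x2}" for x
  proof -
    \<comment> \<open>Raising all heights below \<open>y2\<close> to \<open>y2\<close> leaves a
      monotone function, so the weighted sum remains at most 0. Among the pieces that count over the
      box, only \<open>k\<close> is raised, and its change is the gain.\<close>
    let ?\<phi> = "\<lambda>v. H (Complex x (max v y2))"
    have "G x - (\<Sum>i<n. w i x * ?\<phi> (h i x)) = (\<Sum>i<n. w i x * (H (Complex x (h i x)) - ?\<phi> (h i x)))"
      unfolding G_def by (simp add: sum_subtractf right_diff_distrib)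
    also have "\<dots> = (\<Sum>i<n. if i = k then H (Complex x (h k x)) - H (Complex x y2) else 0)"
      using wk[OF x] hk[OF x] hi[OF _ _ x] y12 by (intro sum.cong) (force simp: max_def)+
    also have "\<dots> = H (Complex x (h k x)) - H (Complex x y2)" using k by simp
    also have "\<dots> \<le> H (Complex x y1) - H (Complex x y2)" using hk[OF x] by (simp add: H_mono)
    finally show ?thesis using abel[of ?\<phi> x] H_mono by (smt (verit) max.mono order_refl)
  qed
  have "compact (c ` {0..T})" by (intro compact_continuous_image continuous_on_cornered_loop[OF c]) simp
  then obtain R where R: "\<And>z. z \<in> c ` {0..T} \<Longrightarrow> norm z \<le> R"
    by (meson bounded_iff compact_imp_bounded)
  have range: "x_range c (r i) (r (Suc i)) \<subseteq> {-R..R}" if i: "i < n" for i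
  proof
    fix x assume "x \<in> x_range c (r i) (r (Suc i))"
    then obtain s where "s \<in> {r i..r (Suc i)}" "x = Re (c s)"
      using graph_piece_x_coordinate(2)[OF graph_partition_piece(1)[OF r i]] by blast
    moreover from this have "norm (c s) \<le> R" using R[of "c s"] graph_partition_piece[OF r i] by auto
    ultimately show "x \<in> {-R..R}" using abs_Re_le_cmod[of "c s"] by auto
  qed
  have G_int: "(G has_integral (\<Sum>i<n. Im (V (m (r (Suc i)))) - Im (V (p (r i))))) {-R..R}"
    unfolding G_def w_def h_def
    using graph_piece_tangent_integral[OF c _ _ _ range] graph_partition_piece[OF r]
    by (intro has_integral_sum) auto
  \<comment> \<open>The value of \<open>Im V\<close> on departure, with the end \<open>T\<close>
    read as the start \<open>0\<close>. At good corners the value on arrival is at least as large,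
    so the sum of increments dominates one that telescopes around the loop.\<close>
  define q where "q i = Im (V (p (if i = n then 0 else r i)))" for i
  have "q n - q 0 = (\<Sum>i<n. q (Suc i) - q i)" by (rule sum_lessThan_telescope[symmetric])
  also have "\<dots> \<le> (\<Sum>i<n. Im (V (m (r (Suc i)))) - Im (V (p (r i))))"
  proof (rule sum_mono)
    fix i assume i: "i \<in> {..<n}"
    then have gp: "0 \<le> r i" "r i < r (Suc i)" using graph_partition_piece[OF r, of i] by auto
    have "q (Suc i) \<le> Im (V (m (r (Suc i))))"
    proof (cases "Suc i = n")
      case True
      then show ?thesis using cornered_loopD(6)[OF c] r0n by (simp add: q_def)
    next
      case False
      then have "r (Suc i) < T" using graph_partition_piece[OF r, of "Suc i"] i by simp
      then show ?thesis using cornered_loopD(5)[OF c, of "r (Suc i)"] gp False by (simp add: q_def)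
    qed
    then show "q (Suc i) - q i \<le> Im (V (m (r (Suc i)))) - Im (V (p (r i)))"
      using i by (simp add: q_def)
  qed
  also have "q n = q 0" using r0n by (simp add: q_def)
  finally have I: "0 \<le> (\<Sum>i<n. Im (V (m (r (Suc i)))) - Im (V (p (r i))))" by simp
  define D where "D x = H (Complex x y2) - H (Complex x y1)" for x
  have contD: "continuous_on {x1..x2} D"
    unfolding D_def Complex_eq by (intro continuous_intros continuous_on_compose2[OF H_cont]) auto
  then have "(D has_integral integral {x1..x2} D) {x1..x2}"
    by (intro integrable_integral integrable_continuous_interval)
  then have "((\<lambda>x. - D x) has_integral - integral {x1..x2} D) {x1..x2}"
    by (rule has_integral_neg)
  moreover have "{x1..x2} \<subseteq> {-R..R}"
    using wk range[OF k] wt_nonzero unfolding w_def by (metis subset_iff zero_neq_one)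
  ultimately have "((\<lambda>x. if x \<in> {x1..x2} then - D x else 0) has_integral - integral {x1..x2} D) {-R..R}"
    by (simp only: has_integral_restrict)
  \<comment> \<open>\<open>G\<close> is at most \<open>- D\<close> over the box and at most 0
    elsewhere, so its nonnegative integral leaves no room for a positive integral of
    \<open>D\<close>.\<close>
  from has_integral_le[OF G_int this]
  have "(\<Sum>i<n. Im (V (m (r (Suc i)))) - Im (V (p (r i)))) \<le> - integral {x1..x2} D"
    using G_le G_box by (auto simp: D_def)
  then have "integral {x1..x2} D \<le> 0" using I by simp
  moreover have D0: "0 \<le> D x" for x using H_mono[of y1 y2 x] y12 by (simp add: D_def)
  then have "0 \<le> integral {x1..x2} D"
    using contD by (intro integral_nonneg integrable_continuous_interval)
  ultimately have "integral {x1..x2} D = 0" by simp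
  then have "\<forall>x\<in>{x1..x2}. D x = 0"
    using integral_eq_0_iff[OF contD x12] D0 by blast
  then show False using H_strict[OF x12 y12] by (fastforce simp: D_def)
qed

theorem no_closed_trajectory:
  assumes "L > 0" "\<Gamma> L = \<Gamma> 0" "V L = V 0"
  shows False
  using ex_simple_cornered_loop_of_closed[OF assms] no_simple_cornered_loop by blast

end

section \<open>Monotonicity from an almost everywhere condition on the gradient\<close>

lemma AE_lebesgue_translate:
  fixes v :: "'a::euclidean_space"
  assumes "AE x in lebesgue. P x"
  shows "AE x in lebesgue. P (x + v)"
proof -
  obtain N where N: "N \<in> null_sets lebesgue" "{x. \<not> P x} \<subseteq> N"
    using assms unfolding eventually_ae_filter by auto
  have "negligible ((+) (- v) ` N)"
    using N(1) by (intro negligible_translation) (simp add: negligible_iff_null_sets)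
  moreover have "x \<in> (+) (- v) ` N" if "\<not> P (x + v)" for x
    using N(2) that by (intro image_eqI[of _ _ "x + v"]) auto
  ultimately show ?thesis
    by (intro AE_I'[of "(+) (- v) ` N"]) (auto simp: negligible_iff_null_sets)
qed

text \<open>Along a single line \<open>H\<close> may be differentiable nowhere, so translates of
  \<open>H\<close> are averaged over the ball. The difference quotients are bounded by the Lipschitz
  condition; hence the average is differentiable in \<open>t\<close>, and its derivative is the
  integral of an almost everywhere positive function.\<close>

lemma ex_strict_increase_in_ball:
  fixes H :: "'a::euclidean_space \<Rightarrow> real"
  assumes lip: "K-lipschitz_on UNIV H"
    and ae: "AE x in lebesgue. \<exists>D. GDERIV H x :> D \<and> D \<bullet> e > 0"
    and "\<rho> > 0" "\<tau> > 0"
  shows "\<exists>x\<in>ball a \<rho>. H x < H (x + \<tau> *\<^sub>R e)"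
proof -
  define M where "M = lebesgue_on (ball a \<rho>)"
  have contH: "continuous_on S H" for S
    using lipschitz_on_continuous_on[OF lip] continuous_on_subset by blast
  have K: "K \<ge> 0" using lip by (rule lipschitz_on_nonneg)
  have lipD: "\<bar>H x - H y\<bar> \<le> K * norm (x - y)" for x y
    using lipschitz_onD[OF lip, of x y] by (simp add: dist_norm)
  interpret M: finite_measure M
    unfolding M_def by (rule finite_measure_lebesgue_on) simp
  have measH: "(\<lambda>x. H (x + v)) \<in> borel_measurable M" for v
    unfolding M_def
    by (intro continuous_imp_measurable_on_sets_lebesgue continuous_on_compose2[OF contH[of UNIV]] continuous_intros) auto
  have intH: "integrable M (\<lambda>x. H (x + v))" for v
  proof (rule M.integrable_const_bound)
    show "AE x in M. norm (H (x + v)) \<le> \<bar>H a\<bar> + K * (\<rho> + norm v)"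
    proof (rule AE_I2)
      fix x assume "x \<in> space M"
      then have "norm (x - a) \<le> \<rho>" by (simp add: M_def space_restrict_space dist_norm norm_minus_commute)
      then have "norm (x + v - a) \<le> \<rho> + norm v"
        using norm_triangle_ineq[of "x - a" v] by (simp add: algebra_simps)
      then have "K * norm (x + v - a) \<le> K * (\<rho> + norm v)" using K by (intro mult_left_mono)
      then show "norm (H (x + v)) \<le> \<bar>H a\<bar> + K * (\<rho> + norm v)"
        using lipD[of "x + v" a] by simp
    qed
  qed (rule measH)
  define F where "F t = integral\<^sup>L M (\<lambda>x. H (x + t *\<^sub>R e))" for t
  have "\<exists>l. (F has_real_derivative l) (at t) \<and> l > 0" for t
  proof -
    define q where "q h x = (H (x + (t + h) *\<^sub>R e) - H (x + t *\<^sub>R e)) / h" for h x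
    \<comment> \<open>The directional derivative as a limit along a sequence, which makes it
      measurable. The points without a limit form a null set.\<close>
    define g where "g x = lim (\<lambda>n. q (inverse (real (Suc n))) x)" for x
    have meas_q: "q h \<in> borel_measurable M" for h
      unfolding q_def by (intro borel_measurable_divide borel_measurable_diff measH borel_measurable_const)
    then have meas_g: "g \<in> borel_measurable M"
      unfolding g_def by (rule borel_measurable_lim_metric)
    have "AE x in lebesgue. x \<in> ball a \<rho> \<longrightarrow> (\<exists>D. GDERIV H (x + t *\<^sub>R e) :> D \<and> D \<bullet> e > 0)"
      using AE_lebesgue_translate[OF ae, of "t *\<^sub>R e"] by (auto elim: eventually_mono)
    then have "AE x in M. \<exists>D. GDERIV H (x + t *\<^sub>R e) :> D \<and> D \<bullet> e > 0"
      unfolding M_def by (subst AE_restrict_space_iff) auto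
    then have lim: "AE x in M. ((\<lambda>h. q h x) \<longlongrightarrow> g x) (at 0) \<and> g x > 0"
    proof eventually_elim
      case (elim x)
      then obtain D where D: "GDERIV H (x + t *\<^sub>R e) :> D" "D \<bullet> e > 0" by blast
      have "((\<lambda>h. H (x + (t + h) *\<^sub>R e)) has_derivative (\<lambda>h. (h *\<^sub>R e) \<bullet> D)) (at 0)"
      proof (rule has_derivative_compose[where g = H and f = "\<lambda>h. x + (t + h) *\<^sub>R e"])
        show "((\<lambda>h. x + (t + h) *\<^sub>R e) has_derivative (\<lambda>h. h *\<^sub>R e)) (at 0)"
          by (auto intro!: derivative_eq_intros)
        show "(H has_derivative (\<lambda>h. h \<bullet> D)) (at (x + (t + 0) *\<^sub>R e))"
          using D(1) by (simp add: gderiv_def)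
      qed
      moreover have "(\<lambda>h. (h *\<^sub>R e) \<bullet> D) = (*) (D \<bullet> e)"
        by (simp add: fun_eq_iff inner_commute)
      ultimately have "((\<lambda>h. H (x + (t + h) *\<^sub>R e)) has_real_derivative D \<bullet> e) (at 0)"
        by (simp only: has_field_derivative_def)
      then have L: "((\<lambda>h. q h x) \<longlongrightarrow> D \<bullet> e) (at 0)"
        unfolding has_field_derivative_iff q_def by simp
      have "(\<lambda>n. q (inverse (real (Suc n))) x) \<longlonglongrightarrow> D \<bullet> e"
        using L LIMSEQ_inverse_real_of_nat
        unfolding tendsto_at_iff_sequentially o_def by (auto simp del: of_nat_Suc)
      then have "g x = D \<bullet> e" unfolding g_def by (rule limI)
      then show ?case using L D(2) by simp
    qed
    have bound: "norm (q h x) \<le> K * norm e" for h x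
    proof (cases "h = 0")
      case False
      have "\<bar>H (x + (t + h) *\<^sub>R e) - H (x + t *\<^sub>R e)\<bar> \<le> K * (\<bar>h\<bar> * norm e)"
        using lipD[of "x + (t + h) *\<^sub>R e" "x + t *\<^sub>R e"] by (simp add: scaleR_add_left)
      then show ?thesis using False by (simp add: q_def field_simps)
    qed (use K in \<open>simp add: q_def\<close>)
    have seq: "integrable M g \<and> (\<lambda>i. integral\<^sup>L M (q (X i))) \<longlonglongrightarrow> integral\<^sup>L M g"
      if X: "\<And>i. X i \<noteq> 0" "X \<longlonglongrightarrow> 0" for X :: "nat \<Rightarrow> real"
    proof -
      have "AE x in M. (\<lambda>i. q (X i) x) \<longlonglongrightarrow> g x"
        using lim
      proof eventually_elim
        case (elim x)
        then show ?case using X unfolding tendsto_at_iff_sequentially o_def by auto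
      qed
      then show ?thesis
        using integrable_dominated_convergence[OF meas_g meas_q, of "\<lambda>_. K * norm e" X]
          integral_dominated_convergence[OF meas_g meas_q, of "\<lambda>_. K * norm e" X] bound by auto
    qed
    have int_q: "integral\<^sup>L M (q h) = (F (t + h) - F t) / h" for h
      unfolding q_def F_def using intH by simp
    have "(F has_real_derivative integral\<^sup>L M g) (at t)"
      unfolding DERIV_def tendsto_at_iff_sequentially o_def
      using seq by (simp add: int_q)
    moreover have int_g: "integrable M g"
      using seq[of "\<lambda>n. inverse (real (Suc n))"] LIMSEQ_inverse_real_of_nat by simp
    moreover have nonneg: "AE x in M. 0 \<le> g x"
      using lim by eventually_elim simp
    moreover have "integral\<^sup>L M g \<noteq> 0"
    proof
      assume "integral\<^sup>L M g = 0"
      then have "AE x in M. g x = 0"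
        using integral_nonneg_eq_0_iff_AE[OF int_g nonneg] by simp
      with lim have "AE x in M. False" by eventually_elim auto
      then have "emeasure M (space M) = 0" by (simp add: AE_iff_null_sets[of "space M"] null_setsD1)
      then have "emeasure lebesgue (ball a \<rho>) = 0"
        by (simp add: M_def space_restrict_space emeasure_restrict_space)
      then show False using \<open>\<rho> > 0\<close> content_ball_pos[of \<rho> a] by (simp add: measure_def)
    qed
    moreover have "integral\<^sup>L M g \<ge> 0"
      using nonneg by (rule integral_nonneg_AE)
    ultimately show ?thesis by (intro exI[of _ "integral\<^sup>L M g"]) auto
  qed
  then have "F 0 < F \<tau>"
    by (intro DERIV_pos_imp_increasing[OF \<open>\<tau> > 0\<close>]) blast
  moreover have "F \<tau> \<le> F 0" if "\<not> (\<exists>x\<in>ball a \<rho>. H x < H (x + \<tau> *\<^sub>R e))"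
    unfolding F_def
  proof (rule integral_mono[OF intH intH])
    fix x assume "x \<in> space M"
    then have "x \<in> ball a \<rho>" by (simp add: M_def space_restrict_space)
    then show "H (x + \<tau> *\<^sub>R e) \<le> H (x + 0 *\<^sub>R e)" using that by (auto simp: not_less)
  qed
  ultimately show ?thesis by fastforce
qed

text \<open>By continuity a strict decrease would persist on a whole ball, where
  \<open>ex_strict_increase_in_ball\<close> finds a strict increase.\<close>

lemma mono_in_direction:
  fixes H :: "'a::euclidean_space \<Rightarrow> real"
  assumes lip: "K-lipschitz_on UNIV H"
    and ae: "AE x in lebesgue. \<exists>D. GDERIV H x :> D \<and> D \<bullet> e > 0" and "\<tau> \<ge> 0"
  shows "H x \<le> H (x + \<tau> *\<^sub>R e)"
proof (rule ccontr)
  assume less: "\<not> ?thesis"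
  then have "\<tau> > 0" using \<open>\<tau> \<ge> 0\<close> by (cases "\<tau> = 0") auto
  have "continuous_on UNIV H" using lip by (rule lipschitz_on_continuous_on)
  then have "open {y. H (y + \<tau> *\<^sub>R e) < H y}"
    by (intro open_Collect_less continuous_on_compose2[of UNIV H UNIV "\<lambda>y. y + \<tau> *\<^sub>R e"] continuous_intros) auto
  moreover have "x \<in> {y. H (y + \<tau> *\<^sub>R e) < H y}" using less by simp
  ultimately obtain \<rho> where "\<rho> > 0" "ball x \<rho> \<subseteq> {y. H (y + \<tau> *\<^sub>R e) < H y}"
    by (rule openE)
  moreover obtain y where "y \<in> ball x \<rho>" "H y < H (y + \<tau> *\<^sub>R e)"
    using ex_strict_increase_in_ball[OF lip ae \<open>\<rho> > 0\<close> \<open>\<tau> > 0\<close>, of x] by blast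
  ultimately have "H (y + \<tau> *\<^sub>R e) < H y" by blast
  then show False using \<open>H y < H (y + \<tau> *\<^sub>R e)\<close> by simp
qed

section \<open>Closed curves as trajectories\<close>

lemma has_vector_derivative_within_Un:
  assumes "(f has_vector_derivative D) (at x within A)" "(f has_vector_derivative D) (at x within B)"
  shows "(f has_vector_derivative D) (at x within A \<union> B)"
  using assms unfolding has_vector_derivative_def has_derivative_within by (simp add: Lim_within_Un)

lemma periodic_int_shift:
  assumes "\<And>s::real. f (s + L) = f s"
  shows "f (s + of_int k * L) = f s"
proof (induction k arbitrary: s rule: int_induct[where k = 0])
  case (step1 i)
  then show ?case using assms[of "s + of_int i * L"] by (simp add: algebra_simps)
next
  case (step2 i)
  then show ?case using assms[of "s + of_int (i - 1) * L"] by (simp add: algebra_simps)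
qed simp

lemma has_vector_derivative_shift_within:
  fixes f :: "real \<Rightarrow> 'a::real_normed_vector"
  assumes "(f has_vector_derivative D) (at x within S)" "\<And>y. f (y - c) = f y"
  shows "(f has_vector_derivative D) (at (x + c) within (\<lambda>y. y + c) ` S)"
proof -
  have "((f \<circ> (\<lambda>y. y - c)) has_vector_derivative 1 *\<^sub>R D) (at (x + c) within (\<lambda>y. y + c) ` S)"
  proof (rule vector_diff_chain_within)
    show "((\<lambda>y. y - c) has_vector_derivative 1) (at (x + c) within (\<lambda>y. y + c) ` S)"
      by (auto intro!: derivative_eq_intros)
    show "(f has_vector_derivative D) (at (x + c - c) within (\<lambda>y. y - c) ` (\<lambda>y. y + c) ` S)"
      using assms(1) by (simp add: image_image)
  qed
  then show ?thesis using assms(2) by (simp add: o_def)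
qed

lemma
  assumes "C1_closed_curve L \<gamma>"
  shows C1_closed_curve_deriv: "(\<gamma> has_vector_derivative unit_tangent \<gamma> s) (at s)"
    and unit_tangent_periodic: "unit_tangent \<gamma> (s + L) = unit_tangent \<gamma> s"
proof -
  have d: "(\<gamma> has_vector_derivative unit_tangent \<gamma> s) (at s)" for s
    using assms unfolding C1_closed_curve_def unit_tangent_def
    by (auto simp: C1_differentiable_on_eq vector_derivative_works)
  then show "(\<gamma> has_vector_derivative unit_tangent \<gamma> s) (at s)" .
  have "\<gamma> (y + L) = \<gamma> y" for y using assms by (simp add: C1_closed_curve_def)
  from this[of "y - L" for y] have per: "\<gamma> (y - L) = \<gamma> y" for y by simp
  have "(\<gamma> has_vector_derivative unit_tangent \<gamma> s) (at (s + L) within (\<lambda>y. y + L) ` UNIV)"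
    by (rule has_vector_derivative_shift_within[OF d per])
  moreover have "(\<lambda>y. y + L) ` UNIV = UNIV" by (rule surj_plus_right)
  ultimately show "unit_tangent \<gamma> (s + L) = unit_tangent \<gamma> s"
    using d[of "s + L"] vector_derivative_unique_at by metis
qed

text \<open>At a break point both one-sided derivatives of the tangent equal the same prescribed
  vector, so the tangent is differentiable across break points and across the seam between
  \<open>L\<close> and \<open>0\<close>.\<close>

lemma unit_tangent_deriv:
  assumes C1: "C1_closed_curve L \<gamma>" and C2: "piecewise_C2 L \<gamma>" and curv: "has_curvature \<gamma> H"
  shows "(unit_tangent \<gamma> has_vector_derivative H (\<gamma> s) *\<^sub>R unit_normal \<gamma> s) (at s)"
proof -
  define N where "N s = H (\<gamma> s) *\<^sub>R unit_normal \<gamma> s" for s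
  have L: "L > 0" and per\<gamma>: "\<And>s. \<gamma> (s + L) = \<gamma> s" using C1 by (auto simp: C1_closed_curve_def)
  note per_t = unit_tangent_periodic[OF C1]
  have perN: "N (s + L) = N s" for s
    using per\<gamma>[of s] per_t[of s] by (simp add: N_def unit_normal_def)
  obtain m a where a: "a 0 = 0" "a m = L" "\<And>i. i < m \<Longrightarrow> C2_piece \<gamma> (a i) (a (Suc i))"
    using C2 unfolding piecewise_C2_def by blast
  have piece: "(unit_tangent \<gamma> has_vector_derivative N s) (at s within {a i..a (Suc i)})"
    if "i < m" "s \<in> {a i..a (Suc i)}" for i s
    using curv a(3)[OF that(1)] that(2) unfolding has_curvature_def N_def by blast
  have right: "\<exists>\<epsilon>>0. (unit_tangent \<gamma> has_vector_derivative N s) (at s within {s..s + \<epsilon>})"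
    if s: "0 \<le> s" "s < L" for s
  proof -
    \<comment> \<open>The strict inequality selects the piece that continues to the right of a break
      point; for \<open>left\<close>, \<le> selects the one that arrives there.\<close>
    define k where "k = (LEAST i. s < a i)"
    have k: "s < a k" "k \<le> m"
      unfolding k_def using s a(2) by (auto intro: LeastI[of "\<lambda>i. s < a i" m] Least_le)
    then have "k \<noteq> 0" using a(1) s by (intro notI) auto
    then have "\<not> s < a (k - 1)" unfolding k_def by (intro not_less_Least) simp
    then have "(unit_tangent \<gamma> has_vector_derivative N s) (at s within {a (k - 1)..a k})"
      using piece[of "k - 1" s] k \<open>k \<noteq> 0\<close> by auto
    then have "(unit_tangent \<gamma> has_vector_derivative N s) (at s within {s..s + (a k - s)})"
      using \<open>\<not> s < a (k - 1)\<close> by (auto intro: has_vector_derivative_within_subset)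
    then show ?thesis using k by (intro exI[of _ "a k - s"]) auto
  qed
  have left: "\<exists>\<epsilon>>0. (unit_tangent \<gamma> has_vector_derivative N s) (at s within {s - \<epsilon>..s})"
    if s: "0 < s" "s \<le> L" for s
  proof -
    define k where "k = (LEAST i. s \<le> a i)"
    have k: "s \<le> a k" "k \<le> m"
      unfolding k_def using s a(2) by (auto intro: LeastI[of "\<lambda>i. s \<le> a i" m] Least_le)
    then have "k \<noteq> 0" using a(1) s by (intro notI) auto
    then have "\<not> s \<le> a (k - 1)" unfolding k_def by (intro not_less_Least) simp
    then have "(unit_tangent \<gamma> has_vector_derivative N s) (at s within {a (k - 1)..a k})"
      using piece[of "k - 1" s] k \<open>k \<noteq> 0\<close> by auto
    then have "(unit_tangent \<gamma> has_vector_derivative N s) (at s within {s - (s - a (k - 1))..s})"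
      using k by (auto intro: has_vector_derivative_within_subset)
    then show ?thesis using \<open>\<not> s \<le> a (k - 1)\<close> by (intro exI[of _ "s - a (k - 1)"]) auto
  qed
  define k where "k = \<lfloor>s / L\<rfloor>"
  define c where "c = of_int k * L"
  have sh: "f (y - c) = f y" if "\<And>y. f (y + L) = f y" for f :: "real \<Rightarrow> real^2" and y
    using periodic_int_shift[of f L y "- k"] that by (simp add: c_def)
  have s0: "0 \<le> s - c" "s - c < L"
    using L floor_divide_lower[of L s] floor_divide_upper[of L s] by (auto simp: c_def k_def algebra_simps)
  obtain e1 where e1: "e1 > 0" "(unit_tangent \<gamma> has_vector_derivative N (s - c)) (at (s - c) within {s - c..s - c + e1})"
    using right s0 by blast
  have R: "(unit_tangent \<gamma> has_vector_derivative N s) (at s within {s..s + e1})"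
    using has_vector_derivative_shift_within[OF e1(2) sh[of "unit_tangent \<gamma>", OF per_t]] by (simp add: sh[of N, OF perN] add.commute)
  obtain e2 where e2: "e2 > 0" "(unit_tangent \<gamma> has_vector_derivative N s) (at s within {s - e2..s})"
  proof (cases "s - c = 0")
    case False
    then obtain e where e: "e > 0" "(unit_tangent \<gamma> has_vector_derivative N (s - c)) (at (s - c) within {s - c - e..s - c})"
      using left[of "s - c"] s0 by auto
    have "(unit_tangent \<gamma> has_vector_derivative N s) (at s within {s - e..s})"
      using has_vector_derivative_shift_within[OF e(2) sh[of "unit_tangent \<gamma>", OF per_t]] by (simp add: sh[of N, OF perN] add.commute)
    then show thesis using that e(1) by blast
  next
    case True
    \<comment> \<open>Here \<open>s\<close> is a multiple of the period, and no piece arrives at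
      \<open>0\<close>. The left derivative is taken at \<open>L\<close> and carried over by a shift
      that is one period shorter.\<close>
    obtain e where e: "e > 0" "(unit_tangent \<gamma> has_vector_derivative N L) (at L within {L - e..L})"
      using left[of L] L by auto
    have sh': "f (y - (c - L)) = f y" if "\<And>y. f (y + L) = f y" for f :: "real \<Rightarrow> real^2" and y
      using sh[of f "y + L", OF that] that[of y] by (simp add: algebra_simps)
    have "N s = N L" using sh'[of N s, OF perN] True by simp
    moreover have "L + (c - L) = s" "L - e + (c - L) = s - e" using True by simp_all
    ultimately have "(unit_tangent \<gamma> has_vector_derivative N s) (at s within {s - e..s})"
      using has_vector_derivative_shift_within[OF e(2) sh'[of "unit_tangent \<gamma>", OF per_t]]
      unfolding image_add_atLeastAtMost' by simp
    then show thesis using that e(1) by blast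
  qed
  have "(unit_tangent \<gamma> has_vector_derivative N s) (at s within {s - e2..s} \<union> {s..s + e1})"
    by (rule has_vector_derivative_within_Un[OF e2(2) R])
  moreover have "{s - e2..s} \<union> {s..s + e1} = {s - e2..s + e1}" using e1(1) e2(1) by auto
  moreover have "at s within {s - e2..s + e1} = at s" using e1(1) e2(1) by (intro at_within_interior) auto
  ultimately show ?thesis by (simp add: N_def)
qed

theorem theorem1p2:
  fixes H :: "real^2 \<Rightarrow> real"
  assumes "\<And>x. H x > 0"
    and "\<exists>C. C-lipschitz_on UNIV H"
    and "\<exists>e::real^2. AE x in lebesgue. \<exists>D. GDERIV H x :> D \<and> D \<bullet> e > 0"
  shows "\<not> (\<exists>L \<gamma>. C1_closed_curve L \<gamma> \<and> piecewise_C2 L \<gamma> \<and> has_curvature \<gamma> H)"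
proof (intro notI, elim exE conjE)
  fix L \<gamma> assume C1: "C1_closed_curve L \<gamma>" and C2: "piecewise_C2 L \<gamma>" and curv: "has_curvature \<gamma> H"
  obtain K where lip: "K-lipschitz_on UNIV H" using assms(2) by blast
  obtain e :: "real^2" where ae: "AE x in lebesgue. \<exists>D. GDERIV H x :> D \<and> D \<bullet> e > 0"
    using assms(3) by blast
  \<comment> \<open>For \<open>e = 0\<close> the strict increase would read
    \<open>H x < H x\<close>.\<close>
  have "e \<noteq> 0"
    using ex_strict_increase_in_ball[OF lip ae, of 1 1 0] by auto
  \<comment> \<open>\<open>q\<close> is the direction of \<open>e\<close>, and \<open>p\<close> is
    \<open>q\<close> turned clockwise by a right angle. Thus \<open>(p, q)\<close> is positively
    oriented, and the unit normal becomes \<open>\<i> * V s\<close> in these coordinates.\<close>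
  define q where "q = (1 / norm e) *\<^sub>R e"
  define p :: "real^2" where "p = vector [q $ 2, - q $ 1]"
  have q: "norm q = 1" using \<open>e \<noteq> 0\<close> by (simp add: q_def)
  have q_sq: "q $ 1 * q $ 1 + q $ 2 * q $ 2 = 1"
    using q by (simp add: norm_eq_1 inner_vec_def sum_2)
  have p1: "p $ 1 = q $ 2" and p2: "p $ 2 = - q $ 1" by (simp_all add: p_def)
  have p_norm: "norm p = 1"
    using q_sq by (simp add: norm_eq_1 inner_vec_def sum_2 p1 p2 algebra_simps)
  have dot_p: "v \<bullet> p = v $ 1 * q $ 2 - v $ 2 * q $ 1" and dot_q: "v \<bullet> q = v $ 1 * q $ 1 + v $ 2 * q $ 2" for v
    by (simp_all add: inner_vec_def sum_2 p1 p2)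
  have expand: "(v \<bullet> p) *\<^sub>R p + (v \<bullet> q) *\<^sub>R q = v" for v
  proof -
    have "(v $ 1 * q $ 2 - v $ 2 * q $ 1) * q $ 2 + (v $ 1 * q $ 1 + v $ 2 * q $ 2) * q $ 1 = v $ 1"
      "(v $ 1 * q $ 2 - v $ 2 * q $ 1) * (- q $ 1) + (v $ 1 * q $ 1 + v $ 2 * q $ 2) * q $ 2 = v $ 2"
      using q_sq by algebra+
    then show ?thesis by (simp add: vec_eq_iff forall_2 dot_p dot_q p1 p2)
  qed
  define pt where "pt z = Re z *\<^sub>R p + Im z *\<^sub>R q" for z
  define Hz where "Hz z = H (pt z)" for z
  define \<Gamma> where "\<Gamma> s = Complex (\<gamma> s \<bullet> p) (\<gamma> s \<bullet> q)" for s
  define V where "V s = Complex (unit_tangent \<gamma> s \<bullet> p) (unit_tangent \<gamma> s \<bullet> q)" for s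
  have unit: "norm (unit_tangent \<gamma> s) = 1" for s using C1 by (simp add: C1_closed_curve_def)
  have Hz_\<Gamma>: "Hz (\<Gamma> s) = H (\<gamma> s)" for s by (simp add: Hz_def pt_def \<Gamma>_def expand)
  have pt_shift: "pt (Complex x y') = pt (Complex x y) + ((y' - y) / norm e) *\<^sub>R e" for x y y'
  proof -
    have "((y' - y) / norm e) *\<^sub>R e = (y' - y) *\<^sub>R q" by (simp add: q_def)
    then show ?thesis by (simp add: pt_def algebra_simps)
  qed
  have mono: "Hz (Complex x y) \<le> Hz (Complex x y')" if "y \<le> y'" for x y y'
    unfolding Hz_def pt_shift[of x y' y] using that by (intro mono_in_direction[OF lip ae]) simp
  interpret curvature_flow \<Gamma> V Hz
  proof
    fix s
    show "(\<Gamma> has_vector_derivative V s) (at s)"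
      using bounded_linear.has_vector_derivative[OF bounded_linear_inner_left C1_closed_curve_deriv[OF C1]]
      by (auto simp: has_vector_derivative_complex_iff has_real_derivative_iff_has_vector_derivative \<Gamma>_def V_def)
    have n: "unit_normal \<gamma> s = vector [- unit_tangent \<gamma> s $ 2, unit_tangent \<gamma> s $ 1]"
      by (rule unit_normal_eq[OF unit])
    have n_pq: "unit_normal \<gamma> s \<bullet> p = - (unit_tangent \<gamma> s \<bullet> q)" "unit_normal \<gamma> s \<bullet> q = unit_tangent \<gamma> s \<bullet> p"
      unfolding n dot_p dot_q by simp_all
    have "((\<lambda>s. unit_tangent \<gamma> s \<bullet> w) has_vector_derivative H (\<gamma> s) * (unit_normal \<gamma> s \<bullet> w)) (at s)" for w
      using bounded_linear.has_vector_derivative[OF bounded_linear_inner_left unit_tangent_deriv[OF C1 C2 curv]]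
      by simp
    from this[of p] this[of q]
    show "(V has_vector_derivative Hz (\<Gamma> s) *\<^sub>R (\<i> * V s)) (at s)"
      unfolding n_pq Hz_\<Gamma>
      by (auto simp: has_vector_derivative_complex_iff has_real_derivative_iff_has_vector_derivative V_def)
    have "1 = (norm (unit_tangent \<gamma> s))\<^sup>2 * (q $ 1 * q $ 1 + q $ 2 * q $ 2)" by (simp add: unit q_sq)
    also have "\<dots> = (unit_tangent \<gamma> s \<bullet> p)\<^sup>2 + (unit_tangent \<gamma> s \<bullet> q)\<^sup>2"
      unfolding dot_p dot_q power2_norm_eq_inner
      by (simp add: inner_vec_def sum_2 power2_eq_square algebra_simps)
    finally show "norm (V s) = 1" by (simp add: V_def complex_norm)
  next
    show "Hz z > 0" for z using assms(1) by (simp add: Hz_def)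
    show "continuous_on UNIV Hz" unfolding Hz_def pt_def
      by (intro continuous_on_compose2[OF lipschitz_on_continuous_on[OF lip]] continuous_intros) auto
    show "Hz (Complex x y) \<le> Hz (Complex x y')" if "y \<le> y'" for x y y' by (rule mono[OF that])
  next
    fix x1 x2 y1 y2 :: real assume x: "x1 < x2" and y: "y1 < y2"
    \<comment> \<open>The centre lies a third of the way up, so a ball of radius at most a third of
      the height difference stays strictly between \<open>y1\<close> and \<open>y2\<close> even when
      raised by another third.\<close>
    define a where "a = pt (Complex ((x1 + x2) / 2) ((2 * y1 + y2) / 3))"
    define \<rho> where "\<rho> = min ((x2 - x1) / 2) ((y2 - y1) / 3)"
    obtain v where v: "v \<in> ball a \<rho>" "H v < H (v + ((y2 - y1) / 3 / norm e) *\<^sub>R e)"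
      using ex_strict_increase_in_ball[OF lip ae, of \<rho> "(y2 - y1) / 3 / norm e" a] x y \<open>e \<noteq> 0\<close>
      by (auto simp: \<rho>_def)
    have "p \<bullet> p = 1" "q \<bullet> q = 1" "q \<bullet> p = 0" "p \<bullet> q = 0"
      using p_norm q by (auto simp: norm_eq_1 dot_p dot_q p1 p2)
    then have a_pq: "a \<bullet> p = (x1 + x2) / 2" "a \<bullet> q = (2 * y1 + y2) / 3"
      by (simp_all add: a_def pt_def inner_add_left)
    have "\<bar>(v - a) \<bullet> p\<bar> < \<rho>" "\<bar>(v - a) \<bullet> q\<bar> < \<rho>"
      using Cauchy_Schwarz_ineq2[of "v - a" p] Cauchy_Schwarz_ineq2[of "v - a" q] v(1) p_norm q
      by (auto simp: dist_norm norm_minus_commute)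
    then have vp: "x1 < v \<bullet> p" "v \<bullet> p < x2" and vq: "y1 < v \<bullet> q" "v \<bullet> q + (y2 - y1) / 3 < y2"
      unfolding inner_diff_left a_pq \<rho>_def by (auto simp: abs_less_iff field_simps)
    have ptv: "pt (Complex (v \<bullet> p) (v \<bullet> q)) = v" by (simp add: pt_def expand)
    have "Hz (Complex (v \<bullet> p) y1) \<le> Hz (Complex (v \<bullet> p) (v \<bullet> q))" using vq by (intro mono) simp
    also have "\<dots> < Hz (Complex (v \<bullet> p) (v \<bullet> q + (y2 - y1) / 3))"
      using v(2) pt_shift[of "v \<bullet> p" "v \<bullet> q + (y2 - y1) / 3" "v \<bullet> q"] by (simp add: Hz_def ptv)
    also have "\<dots> \<le> Hz (Complex (v \<bullet> p) y2)" using vq by (intro mono) simp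
    finally show "\<exists>x. x1 < x \<and> x < x2 \<and> Hz (Complex x y1) < Hz (Complex x y2)" using vp by blast
  qed
  have "L > 0" "\<gamma> L = \<gamma> 0" "unit_tangent \<gamma> L = unit_tangent \<gamma> 0"
    using C1 unit_tangent_periodic[OF C1, of 0] by (auto simp: C1_closed_curve_def dest: spec[of _ 0])
  then show False using no_closed_trajectory[of L] by (simp add: \<Gamma>_def V_def)
qed

end
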